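(* Let $X$ be a path-connected closure space with basepoint $x_0\in X$, and let $h:\pi_1(X,x_0)\to H_1(X)$ be the Hurewicz map, sending the homotopy class of a loop $f$ to the homology class of $f$ regarded as a singular $1$-cycle. Then $h$ is surjective and its kernel is the commutator subgroup of $\pi_1(X,x_0)$. Hence $H_1(X)$ is the abelianization of $\pi_1(X,x_0)$.
   Context: A (Čech) closure space is a pair $(X,c)$ of a set $X$ and a function $c:2^X\to 2^X$ with $c(\varnothing)=\varnothing$, $A\subset c(A)$, and $c(A\cup B)=c(A)\cup c(B)$ for all $A,B\subset X$. Topological spaces are the closure spaces with $c(c(A))=c(A)$ for all $A$, where $c$ is the topological closure. A map $f:(X,c)\to(Y,d)$ is continuous if $f(c(A))\subset d(f(A))$ for all $A\subset X$. The interior operator is $i(A)=X\setminus c(X\setminus A)$, and $B$ is a neighborhood of $x$ if $x\in i(B)$. The product $X\times Y$ has the closure in which $(x,y)$ is in the closure of $B$ iff $U\times V$ meets $B$ for all neighborhoods $U$ of $x$ in $X$ and $V$ of $y$ in $Y$. $I=[0,1]$ has the standard topology. $X$ is path-connected if any two points $x,y\in X$ are joined by a continuous $\alpha:I\to X$ with $\alpha(0)=x$, $\alpha(1)=y$. Fundamental group: $\pi_1(X,x_0)$ is the set of homotopy classes of continuous maps $f:(I,\partial I)\to (X,x_0)$ (loops at $x_0$), where homotopies are continuous maps $H:I\times I\to X$ that keep the endpoints of $I$ at $x_0$; the group operation is $[f]\cdot[g]=[f\cdot g]$ with $(f\cdot g)(t)=f(2t)$ for $t\le \frac12$ and $(f\cdot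 g)(t)=g(2t-1)$ for $t\ge\frac12$. Singular homology: let $|\Delta^n|=\{(t_0,\dots,t_n)\in\mathbb{R}^{n+1} : \sum_i t_i=1,\ t_i\ge 0\}=[e_0,\dots,e_n]$ with the Euclidean topology. $C_n(X)$ is the free abelian group on continuous maps $\sigma:|\Delta^n|\to X$ (and $C_n(X)=0$ for $n<0$), $\partial_n(\sigma)=\sum_{i=0}^n(-1)^i\sigma|_{[e_0,\dots,\hat e_i,\dots,e_n]}$, and $H_n(X)=\ker\partial_n/\operatorname{im}\partial_{n+1}$. Identifying $I$ with $|\Delta^1|$, a loop is a singular $1$-simplex which is a cycle; $h$ is a well-defined group homomorphism. *)

theory Defs
  imports "HOL-Homology.Homology" "HOL-Algebra.Generated_Groups"
begin

section \<open>Closure spaces\<close>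

text \<open>Only the values of \<open>clos\<close> on subsets of \<open>points\<close> are meaningful; no definition below
  looks at the others.\<close>

record 'a cl_space =
  points :: "'a set"
  clos :: "'a set \<Rightarrow> 'a set"

locale closure_space =
  fixes X :: "'a cl_space"
  assumes clos_subset: "A \<subseteq> points X \<Longrightarrow> clos X A \<subseteq> points X"
    and clos_empty: "clos X {} = {}"
    and clos_incl: "A \<subseteq> points X \<Longrightarrow> A \<subseteq> clos X A"
    and clos_Un: "\<lbrakk>A \<subseteq> points X; B \<subseteq> points X\<rbrakk> \<Longrightarrow> clos X (A \<union> B) = clos X A \<union> clos X B"

definition cl_continuous :: "'a cl_space \<Rightarrow> 'b cl_space \<Rightarrow> ('a \<Rightarrow> 'b) \<Rightarrow> bool" where
  "cl_continuous X Y f \<longleftrightarrow>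
     f \<in> points X \<rightarrow> points Y \<and> (\<forall>A \<subseteq> points X. f ` clos X A \<subseteq> clos Y (f ` A))"

definition cl_interior :: "'a cl_space \<Rightarrow> 'a set \<Rightarrow> 'a set" where
  "cl_interior X A = points X - clos X (points X - A)"

definition cl_nbhd :: "'a cl_space \<Rightarrow> 'a \<Rightarrow> 'a set \<Rightarrow> bool" where
  "cl_nbhd X x B \<longleftrightarrow> B \<subseteq> points X \<and> x \<in> cl_interior X B"

definition cl_prod :: "'a cl_space \<Rightarrow> 'b cl_space \<Rightarrow> ('a \<times> 'b) cl_space" where
  "cl_prod X Y =
     \<lparr>points = points X \<times> points Y,
      clos = (\<lambda>B. {(x, y) \<in> points X \<times> points Y.
                     \<forall>U V. cl_nbhd X x U \<and> cl_nbhd Y y V \<longrightarrow> (U \<times> V) \<inter> B \<noteq> {}})\<rparr>"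

definition cl_of_topology :: "'a topology \<Rightarrow> 'a cl_space" where
  "cl_of_topology T = \<lparr>points = topspace T, clos = (\<lambda>A. T closure_of A)\<rparr>"

lemma closure_space_cl_of_topology: "closure_space (cl_of_topology T)"
  by unfold_locales
    (auto simp: cl_of_topology_def closure_of_subset closure_of_Un
          dest: subsetD[OF closure_of_subset_topspace])

lemma cl_continuous_cl_of_topology:
  "cl_continuous (cl_of_topology S) (cl_of_topology T) f \<longleftrightarrow> continuous_map S T f"
proof
  assume L: "cl_continuous (cl_of_topology S) (cl_of_topology T) f"
  have "f ` (S closure_of A) \<subseteq> T closure_of f ` A" for A
  proof -
    have "f ` (S closure_of (topspace S \<inter> A)) \<subseteq> T closure_of f ` (topspace S \<inter> A)"
      using L by (simp add: cl_continuous_def cl_of_topology_def)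
    also have "\<dots> \<subseteq> T closure_of f ` A"
      by (intro closure_of_mono) auto
    finally show ?thesis
      by (simp flip: closure_of_restrict)
  qed
  then show "continuous_map S T f"
    unfolding continuous_map_eq_image_closure_subset by blast
next
  assume "continuous_map S T f"
  then show "cl_continuous (cl_of_topology S) (cl_of_topology T) f"
    by (simp add: continuous_map_eq_image_closure_subset_gen cl_continuous_def cl_of_topology_def
                  image_subset_iff_funcset)
qed

definition cl_I :: "real cl_space" where
  "cl_I = cl_of_topology (top_of_set {0..1})"

definition cl_path_connected :: "'a cl_space \<Rightarrow> bool" where
  "cl_path_connected X \<longleftrightarrow>
     (\<forall>x \<in> points X. \<forall>y \<in> points X. \<exists>\<alpha>. cl_continuous cl_I X \<alpha> \<and> \<alpha> 0 = x \<and> \<alpha> 1 = y)"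


section \<open>The fundamental group\<close>

text \<open>As for the library's singular simplices, maps out of the unit interval are represented by
  functions that are \<open>undefined\<close> off the interval, so that a map is a single HOL function.\<close>

definition cl_loops :: "'a cl_space \<Rightarrow> 'a \<Rightarrow> (real \<Rightarrow> 'a) set" where
  "cl_loops X x0 =
     {f \<in> extensional {0..1}. cl_continuous cl_I X f \<and> f 0 = x0 \<and> f 1 = x0}"

definition loop_homotopy :: "'a cl_space \<Rightarrow> 'a \<Rightarrow> ((real \<Rightarrow> 'a) \<times> (real \<Rightarrow> 'a)) set" where
  "loop_homotopy X x0 =
     {(f, g) \<in> cl_loops X x0 \<times> cl_loops X x0.
        \<exists>H. cl_continuous (cl_prod cl_I cl_I) X H \<and>
            (\<forall>s \<in> {0..1}. H (s, 0) = f s \<and> H (s, 1) = g s) \<and>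
            (\<forall>t \<in> {0..1}. H (0, t) = x0 \<and> H (1, t) = x0)}"

definition loop_class :: "'a cl_space \<Rightarrow> 'a \<Rightarrow> (real \<Rightarrow> 'a) \<Rightarrow> (real \<Rightarrow> 'a) set" where
  "loop_class X x0 f = loop_homotopy X x0 `` {f}"

definition loop_concat :: "(real \<Rightarrow> 'a) \<Rightarrow> (real \<Rightarrow> 'a) \<Rightarrow> real \<Rightarrow> 'a" where
  "loop_concat f g = (\<lambda>t \<in> {0..1}. if t \<le> 1/2 then f (2 * t) else g (2 * t - 1))"

definition fundamental_group :: "'a cl_space \<Rightarrow> 'a \<Rightarrow> (real \<Rightarrow> 'a) set monoid" where
  "fundamental_group X x0 =
     \<lparr>carrier = cl_loops X x0 // loop_homotopy X x0,
      monoid.mult = (\<lambda>P Q. \<Union>f \<in> P. \<Union>g \<in> Q. loop_class X x0 (loop_concat f g)),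
      one = loop_class X x0 (\<lambda>t \<in> {0..1}. x0)\<rparr>"


section \<open>Singular homology\<close>

text \<open>The library's \<^const>\<open>standard_simplex\<close>, \<^const>\<open>singular_face\<close> and \<^const>\<open>chain_boundary\<close>
  do not mention the topology of the target space, so they serve for closure spaces as well. Points
  of \<^term>\<open>standard_simplex n\<close> vanish beyond coordinate \<open>n\<close>, hence the product topology on it is the
  Euclidean topology.\<close>

definition cl_simplex :: "nat \<Rightarrow> (nat \<Rightarrow> real) cl_space" where
  "cl_simplex n = cl_of_topology (subtopology (powertop_real UNIV) (standard_simplex n))"

definition cl_singular_simplices :: "nat \<Rightarrow> 'a cl_space \<Rightarrow> ((nat \<Rightarrow> real) \<Rightarrow> 'a) set" where
  "cl_singular_simplices n X =
     {\<sigma> \<in> extensional (standard_simplex n). cl_continuous (cl_simplex n) X \<sigma>}"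

definition cl_chain_group :: "nat \<Rightarrow> 'a cl_space \<Rightarrow> 'a chain monoid" where
  "cl_chain_group n X = free_Abelian_group (cl_singular_simplices n X)"

text \<open>\<^term>\<open>chain_boundary 0\<close> is the zero map, matching the convention that there are no
  chains in negative degrees.\<close>

definition cl_cycle_group :: "nat \<Rightarrow> 'a cl_space \<Rightarrow> 'a chain monoid" where
  "cl_cycle_group n X =
     (cl_chain_group n X)\<lparr>carrier := {c \<in> carrier (cl_chain_group n X). chain_boundary n c = 0}\<rparr>"

definition cl_boundaries :: "nat \<Rightarrow> 'a cl_space \<Rightarrow> 'a chain set" where
  "cl_boundaries n X = chain_boundary (Suc n) ` carrier (cl_chain_group (Suc n) X)"

definition cl_homology_group :: "nat \<Rightarrow> 'a cl_space \<Rightarrow> 'a chain set monoid" where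
  "cl_homology_group n X = cl_cycle_group n X Mod cl_boundaries n X"

definition cl_homology_class :: "nat \<Rightarrow> 'a cl_space \<Rightarrow> 'a chain \<Rightarrow> 'a chain set" where
  "cl_homology_class n X c = cl_boundaries n X #>\<^bsub>cl_cycle_group n X\<^esub> c"


section \<open>The Hurewicz map\<close>

text \<open>The unit interval is identified with the standard 1-simplex by
  \<open>t \<mapsto> (1 - t) e\<^sub>0 + t e\<^sub>1\<close>, whose inverse reads off coordinate 1.\<close>

definition loop_simplex :: "(real \<Rightarrow> 'a) \<Rightarrow> (nat \<Rightarrow> real) \<Rightarrow> 'a" where
  "loop_simplex f = (\<lambda>v \<in> standard_simplex 1. f (v 1))"

text \<open>The union runs over all representatives of the homotopy class. Homotopic loops are
  homologous, so it is a union of copies of a single coset.\<close>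

definition hurewicz :: "'a cl_space \<Rightarrow> (real \<Rightarrow> 'a) set \<Rightarrow> 'a chain set" where
  "hurewicz X P = (\<Union>f \<in> P. cl_homology_class 1 X (frag_of (loop_simplex f)))"

abbreviation commutator_subgroup :: "('g, 'm) monoid_scheme \<Rightarrow> 'g set" where
  "commutator_subgroup G \<equiv> derived G (carrier G)"

definition abelianization :: "('g, 'm) monoid_scheme \<Rightarrow> 'g set monoid" where
  "abelianization G = G Mod commutator_subgroup G"

end

theory Submission
  imports Defs
begin

text \<open>The kernel and the image of the Hurewicz map are determined by an inverse to it on the
  abelianization. Choose for every point \<open>x\<close> a path \<open>\<gamma> x\<close> from \<open>x0\<close> to \<open>x\<close>, constant for
  \<open>x = x0\<close>, and close up a path \<open>f\<close> from \<open>x\<close> to \<open>y\<close> to the loop that runs along \<open>\<gamma> x\<close>, \<open>f\<close> and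
  the reverse of \<open>\<gamma> y\<close> (\<open>based_loop\<close>).

  Kernel: sending \<open>f\<close> to the class of its closed up loop extends to a homomorphism from 1-chains
  to the abelianization of the fundamental group. Two sides of a singular triangle concatenate, up
  to homotopy, to the third side, and closing up respects concatenation
  (\<open>based_loop_concat\<close>), so the homomorphism kills the boundary of every triangle and hence all
  boundaries. On a loop it returns the class of that loop. So a loop that is a boundary has a
  trivial class in the abelianization (\<open>kernel_in_commutators\<close>).

  Image: as a 1-chain, the closed up loop is homologous to \<open>\<gamma> x + f - \<gamma> y\<close>. For a chain \<open>c\<close> the
  total contribution of the base paths depends only on the boundary of \<open>c\<close>, so it vanishes for a
  cycle, which is therefore homologous to a product of closed up loops and their reverses
  (\<open>cycle_homologous_to_loop\<close>).

  Over closure spaces this classical argument needs three things beyond composition with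
  continuous maps. Maps on two closed sets can be pasted, because a closure operator is finitely
  additive (\<open>cl_map_paste\<close>). The closure product \<open>I \<times> I\<close> is the ordinary square
  (\<open>cl_continuous_square_iff\<close>). And all homotopies between reparametrisations take place in a
  convex subset of a normed space, from which they are transported by a single map
  (\<open>path_homotopic_through_convex\<close>); likewise all homologies come from affine triangles in such
  a set (\<open>triangle_homologous\<close>).\<close>

section \<open>Maps from topological spaces to closure spaces\<close>

definition cl_map :: "'b::topological_space set \<Rightarrow> 'a cl_space \<Rightarrow> ('b \<Rightarrow> 'a) \<Rightarrow> bool" where
  "cl_map S X f \<longleftrightarrow> cl_continuous (cl_of_topology (top_of_set S)) X f"

lemma cl_map_iff:
  "cl_map S X f \<longleftrightarrow> f ` S \<subseteq> points X \<and> (\<forall>A \<subseteq> S. f ` (S \<inter> closure A) \<subseteq> clos X (f ` A))"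
proof -
  have "S \<inter> closure (S \<inter> A) = S \<inter> closure A" if "A \<subseteq> S" for A
    using that by (simp add: Int_absorb1)
  then show ?thesis
    by (auto simp: cl_map_def cl_continuous_def cl_of_topology_def closure_of_subtopology Pi_iff
        Int_absorb1 image_subset_iff)
qed

lemma cl_map_in_points: "cl_map S X f \<Longrightarrow> x \<in> S \<Longrightarrow> f x \<in> points X"
  unfolding cl_map_iff by blast

lemma cl_map_closureD:
  "cl_map S X f \<Longrightarrow> A \<subseteq> S \<Longrightarrow> y \<in> S \<Longrightarrow> y \<in> closure A \<Longrightarrow> f y \<in> clos X (f ` A)"
  unfolding cl_map_iff by blast

lemma cl_mapI:
  assumes "\<And>x. x \<in> S \<Longrightarrow> f x \<in> points X"
    and "\<And>A y. A \<subseteq> S \<Longrightarrow> y \<in> S \<Longrightarrow> y \<in> closure A \<Longrightarrow> f y \<in> clos X (f ` A)"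
  shows "cl_map S X f"
  using assms unfolding cl_map_iff by blast

lemma cl_map_cong:
  assumes "\<And>x. x \<in> S \<Longrightarrow> f x = g x"
  shows "cl_map S X f \<longleftrightarrow> cl_map S X g"
proof -
  have "f ` A = g ` A" if "A \<subseteq> S" for A
    using assms that by (intro image_cong) auto
  then show ?thesis
    by (simp add: cl_map_iff)
qed

lemma cl_map_compose:
  assumes f: "cl_map T X f" and g: "continuous_on S g" "g ` S \<subseteq> T"
  shows "cl_map S X (\<lambda>x. f (g x))"
proof (rule cl_mapI)
  show "f (g x) \<in> points X" if "x \<in> S" for x
    using that g cl_map_in_points[OF f] by blast
  show "f (g y) \<in> clos X ((\<lambda>x. f (g x)) ` A)" if A: "A \<subseteq> S" and y: "y \<in> S" "y \<in> closure A" for A y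
  proof -
    have "continuous_map (top_of_set S) euclidean g"
      using g(1) by simp
    then have "g ` (top_of_set S closure_of A) \<subseteq> euclidean closure_of (g ` A)"
      by (rule continuous_map_image_closure_subset)
    then have "g y \<in> closure (g ` A)"
      using A y by (auto simp: closure_of_subtopology Int_absorb1)
    then show ?thesis
      using cl_map_closureD[OF f, of "g ` A" "g y"] A y g(2) by (auto simp: image_image)
  qed
qed

lemma (in closure_space) cl_map_const:
  assumes "x \<in> points X"
  shows "cl_map S X (\<lambda>_. x)"
proof (rule cl_mapI)
  fix A :: "'b set" and y assume "y \<in> closure A"
  then have "A \<noteq> {}" by auto
  then show "x \<in> clos X ((\<lambda>_. x) ` A)"
    using clos_incl[of "{x}"] assms by (simp add: image_constant_conv)
qed (use assms in auto)

lemma (in closure_space) clos_mono: "A \<subseteq> B \<Longrightarrow> B \<subseteq> points X \<Longrightarrow> clos X A \<subseteq> clos X B"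
  using clos_Un[of A B] by (metis Un_upper1 order_trans sup.absorb2)

text \<open>A set \<open>A\<close> is the union of its parts in \<open>S\<close> and in \<open>T\<close>, and so is its closure; as \<open>S\<close> and \<open>T\<close>
  are closed, a point of the closure of one part lies where \<open>h\<close> is known to be continuous.\<close>

lemma (in closure_space) cl_map_paste:
  assumes f: "cl_map S X f" and g: "cl_map T X g" and "closed S" "closed T"
    and eq: "\<And>x. x \<in> S \<Longrightarrow> h x = f x" "\<And>x. x \<in> T \<Longrightarrow> h x = g x"
  shows "cl_map (S \<union> T) X h"
proof -
  have hS: "cl_map S X h" and hT: "cl_map T X h"
    using f g cl_map_cong[of S h f] cl_map_cong[of T h g] eq by simp_all
  have pts: "h y \<in> points X" if "y \<in> S \<union> T" for y
    using that cl_map_in_points[OF hS] cl_map_in_points[OF hT] by blast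
  show ?thesis
  proof (rule cl_mapI[OF pts])
    fix A y assume A: "A \<subseteq> S \<union> T" and y: "y \<in> closure A"
    have sub: "h ` A \<subseteq> points X" using pts A by blast
    have *: "h y \<in> clos X (h ` A)"
      if R: "cl_map R X h" "closed R" "y \<in> closure (A \<inter> R)" for R
    proof -
      have "y \<in> R"
        using closure_minimal[of "A \<inter> R" R] R by auto
      then have "h y \<in> clos X (h ` (A \<inter> R))"
        using cl_map_closureD[OF R(1)] R(3) by simp
      then show ?thesis
        using clos_mono[of "h ` (A \<inter> R)" "h ` A"] sub by blast
    qed
    have "A = (A \<inter> S) \<union> (A \<inter> T)" using A by blast
    then have "closure A = closure (A \<inter> S) \<union> closure (A \<inter> T)" by (metis closure_Un)
    with y * hS hT \<open>closed S\<close> \<open>closed T\<close> show "h y \<in> clos X (h ` A)" by auto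
  qed
qed

abbreviation (input) unit_square :: "(real \<times> real) set" where
  "unit_square \<equiv> {0..1} \<times> {0..1}"

lemma cl_nbhd_cl_I_iff: "cl_nbhd cl_I x U \<longleftrightarrow> U \<subseteq> {0..1} \<and> x \<in> top_of_set {0..1} interior_of U"
  by (auto simp: cl_nbhd_def cl_interior_def cl_I_def cl_of_topology_def interior_of_closure_of)

text \<open>The neighbourhoods of a point in a topological space are the sets with that point in their
  topological interior, so the closure of the product is that of the product topology.\<close>

lemma clos_cl_prod_cl_I:
  "clos (cl_prod cl_I cl_I) B = top_of_set unit_square closure_of B"
proof -
  let ?I = "top_of_set {0..1::real}"
  have top: "top_of_set unit_square = prod_topology ?I ?I"
    by (simp add: prod_topology_subtopology subtopology_subtopology Times_Int_Times)
  have "(x, y) \<in> clos (cl_prod cl_I cl_I) B \<longleftrightarrow> (x, y) \<in> top_of_set unit_square closure_of B" for x y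
  proof
    assume L: "(x, y) \<in> clos (cl_prod cl_I cl_I) B"
    have xy: "x \<in> {0..1}" "y \<in> {0..1}"
      using L by (auto simp: cl_prod_def cl_I_def cl_of_topology_def)
    have "\<exists>z. z \<in> B \<and> z \<in> W" if W: "(x, y) \<in> W" "openin (prod_topology ?I ?I) W" for W
    proof -
      obtain U V where UV: "openin ?I U" "openin ?I V" "x \<in> U" "y \<in> V" "U \<times> V \<subseteq> W"
        using W unfolding openin_prod_topology_alt by meson
      then have "cl_nbhd cl_I x U" "cl_nbhd cl_I y V"
        by (simp_all add: cl_nbhd_cl_I_iff interior_of_openin)
           (use openin_subset[OF UV(1)] openin_subset[OF UV(2)] in auto)
      then have "U \<times> V \<inter> B \<noteq> {}"
        using L by (auto simp: cl_prod_def)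
      with UV show ?thesis by blast
    qed
    with xy show "(x, y) \<in> top_of_set unit_square closure_of B"
      unfolding top in_closure_of by simp
  next
    assume R: "(x, y) \<in> top_of_set unit_square closure_of B"
    then have xy: "x \<in> {0..1}" "y \<in> {0..1}"
      by (auto simp: in_closure_of)
    have "U \<times> V \<inter> B \<noteq> {}" if UV: "cl_nbhd cl_I x U" "cl_nbhd cl_I y V" for U V
    proof -
      let ?W = "(?I interior_of U) \<times> (?I interior_of V)"
      have "openin (prod_topology ?I ?I) ?W"
        unfolding openin_prod_Times_iff by simp
      moreover have "(x, y) \<in> ?W"
        using UV by (simp add: cl_nbhd_cl_I_iff)
      moreover have "\<forall>T. (x, y) \<in> T \<and> openin (prod_topology ?I ?I) T \<longrightarrow> (\<exists>z. z \<in> B \<and> z \<in> T)"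
        using R unfolding top in_closure_of by (rule conjunct2)
      ultimately have "\<exists>z. z \<in> B \<and> z \<in> ?W"
        by metis
      moreover have "?W \<subseteq> U \<times> V"
        using interior_of_subset[of ?I U] interior_of_subset[of ?I V] by blast
      ultimately show ?thesis by blast
    qed
    with xy show "(x, y) \<in> clos (cl_prod cl_I cl_I) B"
      by (auto simp: cl_prod_def cl_I_def cl_of_topology_def)
  qed
  then show ?thesis
    by (simp only: set_eq_iff split_paired_All) blast
qed

lemma cl_continuous_square_iff:
  "cl_continuous (cl_prod cl_I cl_I) X H \<longleftrightarrow> cl_map unit_square X H"
proof -
  have "points (cl_prod cl_I cl_I) = unit_square"
    by (simp add: cl_prod_def cl_I_def cl_of_topology_def)
  then show ?thesis
    unfolding cl_map_def cl_continuous_def clos_cl_prod_cl_I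
    by (simp add: cl_of_topology_def)
qed

section \<open>Paths up to homotopy\<close>

definition cl_path :: "'a cl_space \<Rightarrow> 'a \<Rightarrow> 'a \<Rightarrow> (real \<Rightarrow> 'a) \<Rightarrow> bool" where
  "cl_path X x y f \<longleftrightarrow> cl_map {0..1} X f \<and> f 0 = x \<and> f 1 = y"

text \<open>This relation looks at functions only on the unit interval, so paths need not be undefined
  outside; for loops it agrees with the homotopy relation that defines the fundamental group.\<close>

definition path_homotopic :: "'a cl_space \<Rightarrow> (real \<Rightarrow> 'a) \<Rightarrow> (real \<Rightarrow> 'a) \<Rightarrow> bool" where
  "path_homotopic X f g \<longleftrightarrow> (\<exists>H. cl_map unit_square X H \<and>
     (\<forall>s \<in> {0..1}. H (s, 0) = f s \<and> H (s, 1) = g s) \<and>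
     (\<forall>t \<in> {0..1}. H (0, t) = f 0 \<and> H (1, t) = f 1))"

definition path_reverse :: "(real \<Rightarrow> 'a) \<Rightarrow> real \<Rightarrow> 'a" where
  "path_reverse f = (\<lambda>t. f (1 - t))"

lemma cl_path_in_points:
  assumes "cl_path X x y f"
  shows "x \<in> points X" "y \<in> points X"
  using assms cl_map_in_points[of "{0..1}" X f 0] cl_map_in_points[of "{0..1}" X f 1]
  by (auto simp: cl_path_def)

lemma path_homotopicI:
  assumes "cl_map unit_square X H"
    and "\<And>s. 0 \<le> s \<Longrightarrow> s \<le> 1 \<Longrightarrow> H (s, 0) = f s" "\<And>s. 0 \<le> s \<Longrightarrow> s \<le> 1 \<Longrightarrow> H (s, 1) = g s"
    and "\<And>t. 0 \<le> t \<Longrightarrow> t \<le> 1 \<Longrightarrow> H (0, t) = f 0" "\<And>t. 0 \<le> t \<Longrightarrow> t \<le> 1 \<Longrightarrow> H (1, t) = f 1"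
  shows "path_homotopic X f g"
  unfolding path_homotopic_def using assms by (intro exI[of _ H]) simp

lemma path_homotopicE:
  assumes "path_homotopic X f g"
  obtains H where "cl_map unit_square X H"
    and "\<And>s. 0 \<le> s \<Longrightarrow> s \<le> 1 \<Longrightarrow> H (s, 0) = f s" "\<And>s. 0 \<le> s \<Longrightarrow> s \<le> 1 \<Longrightarrow> H (s, 1) = g s"
    and "\<And>t. 0 \<le> t \<Longrightarrow> t \<le> 1 \<Longrightarrow> H (0, t) = f 0" "\<And>t. 0 \<le> t \<Longrightarrow> t \<le> 1 \<Longrightarrow> H (1, t) = f 1"
    and "g 0 = f 0" "g 1 = f 1"
proof -
  obtain H where H: "cl_map unit_square X H"
      "\<forall>s \<in> {0..1}. H (s, 0) = f s \<and> H (s, 1) = g s"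
      "\<forall>t \<in> {0..1}. H (0, t) = f 0 \<and> H (1, t) = f 1"
    using assms unfolding path_homotopic_def by blast
  then have "g 0 = f 0" "g 1 = f 1"
    by (metis atLeastAtMost_iff order_refl zero_le_one)+
  then show ?thesis using H that by simp
qed

lemma path_homotopic_ends:
  assumes "path_homotopic X f g"
  shows "g 0 = f 0" "g 1 = f 1"
  using assms by (blast elim: path_homotopicE)+

lemma path_homotopic_cong:
  assumes "\<And>t. 0 \<le> t \<Longrightarrow> t \<le> 1 \<Longrightarrow> f t = f' t" "\<And>t. 0 \<le> t \<Longrightarrow> t \<le> 1 \<Longrightarrow> g t = g' t"
  shows "path_homotopic X f g \<longleftrightarrow> path_homotopic X f' g'"
  using assms by (simp add: path_homotopic_def)

text \<open>Every homotopy between reparametrised paths below is an instance of the next lemma: a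
  convex set \<open>K\<close> deforms its paths linearly, and a map out of \<open>K\<close> carries this deformation over.
  The laws for concatenation and the boundaries of triangles follow by choosing \<open>K\<close>.\<close>

lemma path_homotopic_through_convex:
  fixes p q :: "real \<Rightarrow> 'b::real_normed_vector"
  assumes F: "cl_map K X F" and K: "convex K"
    and p: "continuous_on {0..1} p" "\<And>t. 0 \<le> t \<Longrightarrow> t \<le> 1 \<Longrightarrow> p t \<in> K"
    and q: "continuous_on {0..1} q" "\<And>t. 0 \<le> t \<Longrightarrow> t \<le> 1 \<Longrightarrow> q t \<in> K"
    and ends: "q 0 = p 0" "q 1 = p 1"
    and f: "\<And>t. 0 \<le> t \<Longrightarrow> t \<le> 1 \<Longrightarrow> f t = F (p t)"
    and g: "\<And>t. 0 \<le> t \<Longrightarrow> t \<le> 1 \<Longrightarrow> g t = F (q t)"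
  shows "path_homotopic X f g"
proof -
  define D where "D = (\<lambda>z::real\<times>real. (1 - snd z) *\<^sub>R p (fst z) + snd z *\<^sub>R q (fst z))"
  have cp: "continuous_on unit_square (\<lambda>z. p (fst z))"
    by (rule continuous_on_compose2[OF p(1)]) (auto intro: continuous_intros)
  have cq: "continuous_on unit_square (\<lambda>z. q (fst z))"
    by (rule continuous_on_compose2[OF q(1)]) (auto intro: continuous_intros)
  have "continuous_on unit_square D"
    unfolding D_def by (intro continuous_intros cp cq)
  moreover have "D ` unit_square \<subseteq> K"
    using p(2) q(2) K by (auto simp: D_def intro!: convexD_alt)
  ultimately have "cl_map unit_square X (\<lambda>z. F (D z))"
    by (rule cl_map_compose[OF F])
  then show ?thesis
    by (rule path_homotopicI) (simp_all add: D_def f g ends flip: scaleR_left_distrib)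
qed

lemma path_homotopic_refl:
  assumes "cl_map {0..1} X f"
  shows "path_homotopic X f f"
  using assms
  by (rule path_homotopic_through_convex[where p = "\<lambda>t. t" and q = "\<lambda>t. t"]) auto

lemma path_homotopic_sym:
  assumes "path_homotopic X f g"
  shows "path_homotopic X g f"
proof -
  obtain H where H: "cl_map unit_square X H"
    and "\<And>s. 0 \<le> s \<Longrightarrow> s \<le> 1 \<Longrightarrow> H (s, 0) = f s" "\<And>s. 0 \<le> s \<Longrightarrow> s \<le> 1 \<Longrightarrow> H (s, 1) = g s"
    and "\<And>t. 0 \<le> t \<Longrightarrow> t \<le> 1 \<Longrightarrow> H (0, t) = f 0" "\<And>t. 0 \<le> t \<Longrightarrow> t \<le> 1 \<Longrightarrow> H (1, t) = f 1"
    and "g 0 = f 0" "g 1 = f 1"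
    using assms by (rule path_homotopicE) (rule that)
  moreover have "cl_map unit_square X (\<lambda>z. H (fst z, 1 - snd z))"
    by (rule cl_map_compose[OF H]) (auto intro!: continuous_intros)
  ultimately show ?thesis
    by (intro path_homotopicI[of X "\<lambda>z. H (fst z, 1 - snd z)"]) auto
qed

context closure_space
begin

text \<open>Placing two squares side by side serves both concatenation, along the path parameter, and
  transitivity of homotopy, along the deformation parameter.\<close>

lemma cl_map_join_squares:
  assumes H: "cl_map unit_square X H" and K: "cl_map unit_square X K"
    and eq: "\<And>t. 0 \<le> t \<Longrightarrow> t \<le> 1 \<Longrightarrow> H (1, t) = K (0, t)"
  shows "cl_map unit_square X
           (\<lambda>z. if fst z \<le> 1/2 then H (2 * fst z, snd z) else K (2 * fst z - 1, snd z))"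
proof -
  let ?L = "{0..1/2} \<times> {0..1::real}" and ?R = "{1/2..1::real} \<times> {0..1::real}"
  have L: "cl_map ?L X (\<lambda>z. H (2 * fst z, snd z))"
    by (rule cl_map_compose[OF H]) (auto intro!: continuous_intros)
  have R: "cl_map ?R X (\<lambda>z. K (2 * fst z - 1, snd z))"
    by (rule cl_map_compose[OF K]) (auto intro!: continuous_intros)
  have "cl_map (?L \<union> ?R) X
           (\<lambda>z. if fst z \<le> 1/2 then H (2 * fst z, snd z) else K (2 * fst z - 1, snd z))"
  proof (rule cl_map_paste[OF L R])
    fix z :: "real \<times> real" assume "z \<in> ?R"
    then show "(if fst z \<le> 1/2 then H (2 * fst z, snd z) else K (2 * fst z - 1, snd z))
                 = K (2 * fst z - 1, snd z)"
      using eq[of "snd z"] by (cases "2 * fst z = 1") auto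
  qed (auto intro: closed_Times)
  moreover have "?L \<union> ?R = unit_square" by auto
  ultimately show ?thesis by simp
qed

lemma path_homotopic_trans:
  assumes "path_homotopic X f g" "path_homotopic X g h"
  shows "path_homotopic X f h"
proof -
  obtain H where H: "cl_map unit_square X H"
    and H': "\<And>s. 0 \<le> s \<Longrightarrow> s \<le> 1 \<Longrightarrow> H (s, 0) = f s" "\<And>s. 0 \<le> s \<Longrightarrow> s \<le> 1 \<Longrightarrow> H (s, 1) = g s"
      "\<And>t. 0 \<le> t \<Longrightarrow> t \<le> 1 \<Longrightarrow> H (0, t) = f 0" "\<And>t. 0 \<le> t \<Longrightarrow> t \<le> 1 \<Longrightarrow> H (1, t) = f 1"
      "g 0 = f 0" "g 1 = f 1"
    using assms(1) by (rule path_homotopicE) (rule that)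
  obtain K where K: "cl_map unit_square X K"
    and K': "\<And>s. 0 \<le> s \<Longrightarrow> s \<le> 1 \<Longrightarrow> K (s, 0) = g s" "\<And>s. 0 \<le> s \<Longrightarrow> s \<le> 1 \<Longrightarrow> K (s, 1) = h s"
      "\<And>t. 0 \<le> t \<Longrightarrow> t \<le> 1 \<Longrightarrow> K (0, t) = g 0" "\<And>t. 0 \<le> t \<Longrightarrow> t \<le> 1 \<Longrightarrow> K (1, t) = g 1"
    using assms(2) by (rule path_homotopicE) (rule that)
  \<comment> \<open>exchange the coordinates, so that the squares are joined along the time direction\<close>
  define J where "J = (\<lambda>z::real\<times>real. if fst z \<le> 1/2 then H (snd z, 2 * fst z)
                                         else K (snd z, 2 * fst z - 1))"
  have "cl_map unit_square X (\<lambda>z. H (snd z, fst z))" "cl_map unit_square X (\<lambda>z. K (snd z, fst z))"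
    by (rule cl_map_compose[OF H] cl_map_compose[OF K]; auto intro!: continuous_intros)+
  then have J: "cl_map unit_square X J"
    unfolding J_def using cl_map_join_squares[of "\<lambda>z. H (snd z, fst z)" "\<lambda>z. K (snd z, fst z)"]
    by (simp add: H' K' cong: if_cong)
  have "cl_map unit_square X (\<lambda>z. J (snd z, fst z))"
    by (rule cl_map_compose[OF J]) (auto intro!: continuous_intros)
  then show ?thesis
    by (rule path_homotopicI) (auto simp: J_def H' K')
qed

lemma path_homotopic_concat:
  assumes "path_homotopic X f f'" "path_homotopic X g g'" "f 1 = g 0"
  shows "path_homotopic X (loop_concat f g) (loop_concat f' g')"
proof -
  obtain H where H: "cl_map unit_square X H"
    and H': "\<And>s. 0 \<le> s \<Longrightarrow> s \<le> 1 \<Longrightarrow> H (s, 0) = f s" "\<And>s. 0 \<le> s \<Longrightarrow> s \<le> 1 \<Longrightarrow> H (s, 1) = f' s"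
      "\<And>t. 0 \<le> t \<Longrightarrow> t \<le> 1 \<Longrightarrow> H (0, t) = f 0" "\<And>t. 0 \<le> t \<Longrightarrow> t \<le> 1 \<Longrightarrow> H (1, t) = f 1"
    using assms(1) by (rule path_homotopicE) (rule that)
  obtain K where K: "cl_map unit_square X K"
    and K': "\<And>s. 0 \<le> s \<Longrightarrow> s \<le> 1 \<Longrightarrow> K (s, 0) = g s" "\<And>s. 0 \<le> s \<Longrightarrow> s \<le> 1 \<Longrightarrow> K (s, 1) = g' s"
      "\<And>t. 0 \<le> t \<Longrightarrow> t \<le> 1 \<Longrightarrow> K (0, t) = g 0" "\<And>t. 0 \<le> t \<Longrightarrow> t \<le> 1 \<Longrightarrow> K (1, t) = g 1"
    using assms(2) by (rule path_homotopicE) (rule that)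
  have "cl_map unit_square X
          (\<lambda>z. if fst z \<le> 1/2 then H (2 * fst z, snd z) else K (2 * fst z - 1, snd z))"
    using H K by (rule cl_map_join_squares) (simp add: H' K' assms(3))
  then show ?thesis
    by (rule path_homotopicI) (auto simp: loop_concat_def H' K')
qed

lemma cl_path_concat:
  assumes "cl_path X x y f" "cl_path X y z g"
  shows "cl_path X x z (loop_concat f g)"
proof -
  have f: "cl_map {0..1} X f" and g: "cl_map {0..1} X g" and eq: "f 1 = g 0"
    using assms by (auto simp: cl_path_def)
  have "cl_map unit_square X (\<lambda>z. f (fst z))" "cl_map unit_square X (\<lambda>z. g (fst z))"
    by (rule cl_map_compose[OF f] cl_map_compose[OF g]; auto intro!: continuous_intros)+
  then have "cl_map unit_square X (\<lambda>z. if fst z \<le> 1/2 then f (2 * fst z) else g (2 * fst z - 1))"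
    using cl_map_join_squares[of "\<lambda>z. f (fst z)" "\<lambda>z. g (fst z)"] eq
    by (simp cong: if_cong)
  then have "cl_map {0..1} X (\<lambda>t. (\<lambda>z. if fst z \<le> 1/2 then f (2 * fst z) else g (2 * fst z - 1)) (t, 0 :: real))"
    by (rule cl_map_compose) (auto intro!: continuous_intros)
  then have "cl_map {0..1} X (loop_concat f g)"
    by (rule cl_map_cong[THEN iffD1, rotated]) (simp add: loop_concat_def)
  then show ?thesis
    using assms by (simp add: cl_path_def loop_concat_def)
qed

lemma cl_path_const: "x \<in> points X \<Longrightarrow> cl_path X x x (\<lambda>_. x)"
  by (simp add: cl_path_def cl_map_const)

lemma cl_path_reverse:
  assumes "cl_path X x y f"
  shows "cl_path X y x (path_reverse f)"
proof -
  have "cl_map {0..1} X f" using assms by (simp add: cl_path_def)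
  then have "cl_map {0..1} X (\<lambda>t. f (1 - t))"
    by (rule cl_map_compose) (auto intro!: continuous_intros)
  then show ?thesis
    using assms by (simp add: cl_path_def path_reverse_def)
qed

text \<open>Three composable paths fit together to one map on \<open>[0, 3]\<close>, along which the two
  bracketings are the images of two piecewise linear paths from \<open>0\<close> to \<open>3\<close>.\<close>

lemma path_homotopic_assoc:
  assumes "cl_path X x y f" "cl_path X y z g" "cl_path X z w h"
  shows "path_homotopic X (loop_concat (loop_concat f g) h) (loop_concat f (loop_concat g h))"
proof -
  have f: "cl_map {0..1} X f" and g: "cl_map {0..1} X g" and h: "cl_map {0..1} X h"
    and eq: "f 1 = g 0" "g 1 = h 0"
    using assms by (auto simp: cl_path_def)
  define F where "F = (\<lambda>t::real. if t \<le> 1 then f t else if t \<le> 2 then g (t - 1) else h (t - 2))"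
  have g': "cl_map {1..2} X (\<lambda>t. g (t - 1))"
    by (rule cl_map_compose[OF g]) (auto intro!: continuous_intros)
  have h': "cl_map {2..3} X (\<lambda>t. h (t - 2))"
    by (rule cl_map_compose[OF h]) (auto intro!: continuous_intros)
  have "cl_map ({1..2} \<union> {2..3}) X (\<lambda>t::real. if t \<le> 2 then g (t - 1) else h (t - 2))"
    by (rule cl_map_paste[OF g' h']) (use eq in force)+
  then have "cl_map ({0..1} \<union> ({1..2} \<union> {2..3})) X F"
    by (rule cl_map_paste[OF f]) (use eq in \<open>force simp: F_def\<close>)+
  moreover have "{0..1} \<union> ({1..2} \<union> {2..3}) = {0..3::real}" by auto
  ultimately have F: "cl_map {0..3} X F" by simp
  show ?thesis
  proof (rule path_homotopic_through_convex[OF F])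
    show "loop_concat (loop_concat f g) h t = F (min (4 * t) (2 * t + 1))" if "0 \<le> t" "t \<le> 1" for t
      using that by (auto simp: F_def loop_concat_def min_def)
    show "loop_concat f (loop_concat g h) t = F (max (2 * t) (4 * t - 1))" if "0 \<le> t" "t \<le> 1" for t
      using that eq
      by (cases "2 * t \<le> 1") (auto simp: F_def loop_concat_def max_absorb1 max_absorb2)
  qed (auto intro!: continuous_intros)
qed

text \<open>The remaining laws reparametrise \<open>f\<close> itself, by a map of the interval that waits at an end
  or turns back.\<close>

lemma path_homotopic_const_left:
  assumes "cl_path X x y f"
  shows "path_homotopic X (loop_concat (\<lambda>_. x) f) f"
proof (rule path_homotopic_through_convex[where K = "{0..1}" and F = f
      and p = "\<lambda>t. max 0 (2 * t - 1)" and q = "\<lambda>t. t"])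
  show "loop_concat (\<lambda>_. x) f t = f (max 0 (2 * t - 1))" if "0 \<le> t" "t \<le> 1" for t
    using assms that
    by (cases "2 * t \<le> 1") (auto simp: cl_path_def loop_concat_def max_absorb1 max_absorb2)
qed (use assms in \<open>auto simp: cl_path_def intro!: continuous_intros\<close>)

lemma path_homotopic_const_right:
  assumes "cl_path X x y f"
  shows "path_homotopic X (loop_concat f (\<lambda>_. y)) f"
proof (rule path_homotopic_through_convex[where K = "{0..1}" and F = f
      and p = "\<lambda>t. min (2 * t) 1" and q = "\<lambda>t. t"])
  show "loop_concat f (\<lambda>_. y) t = f (min (2 * t) 1)" if "0 \<le> t" "t \<le> 1" for t
    using assms that
    by (cases "2 * t \<le> 1") (auto simp: cl_path_def loop_concat_def min_absorb1 min_absorb2)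
qed (use assms in \<open>auto simp: cl_path_def intro!: continuous_intros\<close>)

lemma path_homotopic_reverse_left:
  assumes "cl_path X x y f"
  shows "path_homotopic X (loop_concat (path_reverse f) f) (\<lambda>_. y)"
proof (rule path_homotopic_through_convex[where K = "{0..1}" and F = f
      and p = "\<lambda>t. \<bar>2 * t - 1\<bar>" and q = "\<lambda>_. 1"])
  show "loop_concat (path_reverse f) f t = f (\<bar>2 * t - 1\<bar>)" if "0 \<le> t" "t \<le> 1" for t
    using assms that
    by (cases "2 * t \<le> 1") (auto simp: cl_path_def loop_concat_def path_reverse_def abs_of_nonneg abs_of_nonpos)
qed (use assms in \<open>auto simp: cl_path_def intro!: continuous_intros\<close>)

end

section \<open>The fundamental group\<close>

locale pointed_closure_space = closure_space X for X :: "'a cl_space" +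
  fixes x0 :: 'a
  assumes base_point: "x0 \<in> points X"
begin

lemma cl_loops_iff: "f \<in> cl_loops X x0 \<longleftrightarrow> f \<in> extensional {0..1} \<and> cl_path X x0 x0 f"
  by (auto simp: cl_loops_def cl_path_def cl_map_def cl_I_def)

lemma loop_homotopy_iff:
  "(f, g) \<in> loop_homotopy X x0 \<longleftrightarrow>
     f \<in> cl_loops X x0 \<and> g \<in> cl_loops X x0 \<and> path_homotopic X f g"
  by (auto simp: loop_homotopy_def path_homotopic_def cl_continuous_square_iff cl_loops_def)

lemma restrict_in_cl_loops: "cl_path X x0 x0 f \<Longrightarrow> restrict f {0..1} \<in> cl_loops X x0"
  using cl_map_cong[of "{0..1}" "restrict f {0..1}" f X]
  by (simp add: cl_loops_iff cl_path_def)

lemma loop_concat_in_cl_loops: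
  "cl_path X x0 y f \<Longrightarrow> cl_path X y x0 g \<Longrightarrow> loop_concat f g \<in> cl_loops X x0"
  using cl_path_concat[of x0 y f x0 g] by (simp add: cl_loops_iff loop_concat_def)

lemma equiv_loop_homotopy: "equiv (cl_loops X x0) (loop_homotopy X x0)"
proof (rule equivI)
  show "refl_on (cl_loops X x0) (loop_homotopy X x0)"
    by (auto simp: refl_on_def loop_homotopy_iff cl_loops_iff cl_path_def intro: path_homotopic_refl)
  show "sym (loop_homotopy X x0)"
    by (auto simp: sym_def loop_homotopy_iff intro: path_homotopic_sym)
  show "trans (loop_homotopy X x0)"
    unfolding trans_def loop_homotopy_iff by (blast intro: path_homotopic_trans)
qed (auto simp: loop_homotopy_iff)

lemma loop_class_eq_iff:
  "f \<in> cl_loops X x0 \<Longrightarrow> g \<in> cl_loops X x0 \<Longrightarrow>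
     loop_class X x0 f = loop_class X x0 g \<longleftrightarrow> path_homotopic X f g"
  unfolding loop_class_def
  by (simp add: eq_equiv_class_iff[OF equiv_loop_homotopy] loop_homotopy_iff)

lemma mem_loop_class_iff:
  "f \<in> cl_loops X x0 \<Longrightarrow> g \<in> loop_class X x0 f \<longleftrightarrow> g \<in> cl_loops X x0 \<and> path_homotopic X f g"
  by (auto simp: loop_class_def loop_homotopy_iff)

lemma loop_class_self: "f \<in> cl_loops X x0 \<Longrightarrow> f \<in> loop_class X x0 f"
  using mem_loop_class_iff loop_class_eq_iff by blast

lemma carrier_fundamental_group:
  "carrier (fundamental_group X x0) = loop_class X x0 ` cl_loops X x0"
  by (auto simp: fundamental_group_def quotient_def loop_class_def)

lemma one_fundamental_group:
  "\<one>\<^bsub>fundamental_group X x0\<^esub> = loop_class X x0 (\<lambda>t \<in> {0..1}. x0)"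
  by (simp add: fundamental_group_def)

lemma mult_fundamental_group:
  assumes f: "f \<in> cl_loops X x0" and g: "g \<in> cl_loops X x0"
  shows "loop_class X x0 f \<otimes>\<^bsub>fundamental_group X x0\<^esub> loop_class X x0 g =
    loop_class X x0 (loop_concat f g)"
proof -
  have "loop_class X x0 (loop_concat f' g') = loop_class X x0 (loop_concat f g)"
    if "f' \<in> loop_class X x0 f" "g' \<in> loop_class X x0 g" for f' g'
  proof -
    have hom: "f' \<in> cl_loops X x0" "g' \<in> cl_loops X x0" "path_homotopic X f f'" "path_homotopic X g g'"
      using that f g by (simp_all add: mem_loop_class_iff)
    have "path_homotopic X (loop_concat f g) (loop_concat f' g')"
      using hom f g by (intro path_homotopic_concat) (simp_all add: cl_loops_iff cl_path_def)
    moreover have "loop_concat f g \<in> cl_loops X x0" "loop_concat f' g' \<in> cl_loops X x0"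
      using hom(1,2) f g unfolding cl_loops_iff
      by (meson cl_loops_iff loop_concat_in_cl_loops)+
    ultimately show ?thesis
      by (metis loop_class_eq_iff)
  qed
  then show ?thesis
    using loop_class_self[OF f] loop_class_self[OF g]
    unfolding fundamental_group_def monoid.simps by blast
qed

lemma group_fundamental_group: "group (fundamental_group X x0)"
proof (rule groupI)
  let ?G = "fundamental_group X x0" and ?e = "\<lambda>t \<in> {0..1::real}. x0"
  have path: "cl_path X x0 x0 f" if "f \<in> cl_loops X x0" for f
    using that by (simp add: cl_loops_iff)
  have concat: "loop_concat f g \<in> cl_loops X x0" if "f \<in> cl_loops X x0" "g \<in> cl_loops X x0" for f g
    using loop_concat_in_cl_loops that path by blast
  have e: "?e \<in> cl_loops X x0"
    by (intro restrict_in_cl_loops cl_path_const base_point)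
  show "\<one>\<^bsub>?G\<^esub> \<in> carrier ?G"
    using e by (simp add: carrier_fundamental_group one_fundamental_group)
  fix a assume "a \<in> carrier ?G"
  then obtain f where f: "f \<in> cl_loops X x0" and a: "a = loop_class X x0 f"
    by (auto simp: carrier_fundamental_group)
  have "loop_concat ?e f = loop_concat (\<lambda>_. x0) f"
    by (auto simp: loop_concat_def fun_eq_iff)
  then show "\<one>\<^bsub>?G\<^esub> \<otimes>\<^bsub>?G\<^esub> a = a"
    using path_homotopic_const_left[OF path[OF f]] f e concat[OF e f]
    by (simp add: a one_fundamental_group mult_fundamental_group loop_class_eq_iff)
  show "\<exists>y\<in>carrier ?G. y \<otimes>\<^bsub>?G\<^esub> a = \<one>\<^bsub>?G\<^esub>"
  proof
    let ?r = "restrict (path_reverse f) {0..1}"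
    have r: "?r \<in> cl_loops X x0"
      using restrict_in_cl_loops cl_path_reverse path f by blast
    then show "loop_class X x0 ?r \<in> carrier ?G"
      by (simp add: carrier_fundamental_group)
    have "loop_concat ?r f = loop_concat (path_reverse f) f"
      by (auto simp: loop_concat_def fun_eq_iff)
    moreover have "path_homotopic X (loop_concat (path_reverse f) f) ?e"
      using path_homotopic_reverse_left[OF path[OF f]]
      by (rule path_homotopic_cong[THEN iffD1, rotated 2]) simp_all
    ultimately show "loop_class X x0 ?r \<otimes>\<^bsub>?G\<^esub> a = \<one>\<^bsub>?G\<^esub>"
      using f e r concat[OF r f]
      by (simp add: a one_fundamental_group mult_fundamental_group loop_class_eq_iff)
  qed
  fix b assume "b \<in> carrier ?G"
  then obtain g where g: "g \<in> cl_loops X x0" and b: "b = loop_class X x0 g"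
    by (auto simp: carrier_fundamental_group)
  show "a \<otimes>\<^bsub>?G\<^esub> b \<in> carrier ?G"
    using concat f g by (simp add: a b mult_fundamental_group carrier_fundamental_group)
  fix c assume "c \<in> carrier ?G"
  then obtain h where h: "h \<in> cl_loops X x0" and c: "c = loop_class X x0 h"
    by (auto simp: carrier_fundamental_group)
  show "a \<otimes>\<^bsub>?G\<^esub> b \<otimes>\<^bsub>?G\<^esub> c = a \<otimes>\<^bsub>?G\<^esub> (b \<otimes>\<^bsub>?G\<^esub> c)"
    using path_homotopic_assoc[OF path[OF f] path[OF g] path[OF h]] concat f g h
    by (simp add: a b c mult_fundamental_group loop_class_eq_iff)
qed

end

section \<open>Singular chains in low degrees\<close>

lemma cl_singular_simplices_iff:
  "\<sigma> \<in> cl_singular_simplices n X \<longleftrightarrow>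
     \<sigma> \<in> extensional (standard_simplex n) \<and> cl_map (standard_simplex n) X \<sigma>"
  by (simp add: cl_singular_simplices_def cl_simplex_def cl_map_def euclidean_product_topology)

definition path_chain :: "(real \<Rightarrow> 'a) \<Rightarrow> 'a chain" where
  "path_chain f = frag_of (loop_simplex f)"

definition point_chain :: "'a \<Rightarrow> 'a chain" where
  "point_chain x = frag_of (\<lambda>v \<in> standard_simplex 0. x)"

text \<open>Maps from simplices are handled through maps \<open>F\<close> on subsets of a vector space: this is the
  restriction of \<open>F\<close> to the affine triangle with the given vertices.\<close>

definition triangle :: "('b::real_vector \<Rightarrow> 'a) \<Rightarrow> 'b \<Rightarrow> 'b \<Rightarrow> 'b \<Rightarrow> (nat \<Rightarrow> real) \<Rightarrow> 'a" where
  "triangle F a b c = (\<lambda>v \<in> standard_simplex 2. F (v 0 *\<^sub>R a + v 1 *\<^sub>R b + v 2 *\<^sub>R c))"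

lemma standard_simplex_1_iff:
  "v \<in> standard_simplex (Suc 0) \<longleftrightarrow>
     0 \<le> v (Suc 0) \<and> v (Suc 0) \<le> 1 \<and> v 0 = 1 - v (Suc 0) \<and> (\<forall>i>Suc 0. v i = 0)"
proof
  assume R: "0 \<le> v (Suc 0) \<and> v (Suc 0) \<le> 1 \<and> v 0 = 1 - v (Suc 0) \<and> (\<forall>i>Suc 0. v i = 0)"
  have "0 \<le> v i \<and> v i \<le> 1" for i
  proof -
    consider "i = 0" | "i = Suc 0" | "i > Suc 0" by linarith
    then show ?thesis using R by cases auto
  qed
  then show "v \<in> standard_simplex (Suc 0)"
    using R by (simp add: standard_simplex_def)
qed (auto simp: standard_simplex_def)

lemma sum_atMost_2: "(\<Sum>i\<le>2. f i) = f 0 + f 1 + f 2" for f :: "nat \<Rightarrow> 'b::comm_monoid_add"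
  by (simp add: numeral_2_eq_2)

lemma standard_simplex_2_iff:
  "v \<in> standard_simplex 2 \<longleftrightarrow>
     0 \<le> v 1 \<and> 0 \<le> v 2 \<and> v 1 + v 2 \<le> 1 \<and> v 0 = 1 - v 1 - v 2 \<and> (\<forall>i>2. v i = 0)"
  (is "_ \<longleftrightarrow> ?R")
proof
  assume v: "v \<in> standard_simplex 2"
  then have "0 \<le> v i" "i > 2 \<Longrightarrow> v i = 0" "v 0 + v 1 + v 2 = 1" for i
    by (simp_all add: standard_simplex_def sum_atMost_2)
  from this(1)[of 0] this(1)[of 1] this(1)[of 2] this(2,3) show ?R
    by auto
next
  assume R: ?R
  have "0 \<le> v i \<and> v i \<le> 1" for i
  proof -
    consider "i = 0" | "i = 1" | "i = 2" | "i > 2" by linarith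
    then show ?thesis using R by cases auto
  qed
  then show "v \<in> standard_simplex 2"
    using R by (simp add: standard_simplex_def sum_atMost_2)
qed

lemma path_chain_cong: "(\<And>t. 0 \<le> t \<Longrightarrow> t \<le> 1 \<Longrightarrow> f t = g t) \<Longrightarrow> path_chain f = path_chain g"
  unfolding path_chain_def loop_simplex_def
  by (intro arg_cong[of _ _ frag_of] restrict_ext) (simp add: standard_simplex_1_iff)

lemma boundary_path_chain: "chain_boundary 1 (path_chain f) = point_chain (f 1) - point_chain (f 0)"
proof -
  have "simplical_face k v \<in> standard_simplex (Suc 0)"
    if "v \<in> standard_simplex 0" "k \<le> 1" for k and v :: "nat \<Rightarrow> real"
    using simplical_face_in_standard_simplex[of 1 k v] that by simp
  then have "loop_simplex f (simplical_face 0 v) = f 1" "loop_simplex f (simplical_face 1 v) = f 0"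
    if "v \<in> standard_simplex 0" for v
    using that by (simp_all add: loop_simplex_def)
       (simp_all add: simplical_face_def standard_simplex_0)
  then have "singular_face 1 0 (loop_simplex f) = (\<lambda>v \<in> standard_simplex 0. f 1)"
       "singular_face 1 1 (loop_simplex f) = (\<lambda>v \<in> standard_simplex 0. f 0)"
    by (auto simp: fun_eq_iff singular_face_def restrict_def)
  then show ?thesis
    by (simp add: path_chain_def point_chain_def chain_boundary_of)
qed

lemma boundary_triangle:
  "chain_boundary 2 (frag_of (triangle F a b c)) =
     path_chain (\<lambda>t. F (linepath b c t)) - path_chain (\<lambda>t. F (linepath a c t))
       + path_chain (\<lambda>t. F (linepath a b t))"
proof -
  have "simplical_face k v \<in> standard_simplex 2"
    if "v \<in> standard_simplex (Suc 0)" "k \<le> 2" for k and v :: "nat \<Rightarrow> real"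
    using simplical_face_in_standard_simplex[of 2 k v] that by simp
  then have tri: "triangle F a b c (simplical_face k v) =
      F (simplical_face k v 0 *\<^sub>R a + simplical_face k v 1 *\<^sub>R b + simplical_face k v 2 *\<^sub>R c)"
    if "v \<in> standard_simplex (Suc 0)" "k \<le> 2" for k v
    using that by (simp add: triangle_def)
  have "triangle F a b c (simplical_face 0 v) = F (linepath b c (v 1))"
       "triangle F a b c (simplical_face 1 v) = F (linepath a c (v 1))"
       "triangle F a b c (simplical_face 2 v) = F (linepath a b (v 1))"
    if v: "v \<in> standard_simplex (Suc 0)" for v
  proof -
    have "v 0 = 1 - v 1" using v by (simp add: standard_simplex_1_iff)
    then show "triangle F a b c (simplical_face 0 v) = F (linepath b c (v 1))"
       "triangle F a b c (simplical_face 1 v) = F (linepath a c (v 1))"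
       "triangle F a b c (simplical_face 2 v) = F (linepath a b (v 1))"
      using tri[OF v, of 0] tri[OF v, of 1] tri[OF v, of 2]
      by (simp_all add: simplical_face_def linepath_def)
  qed
  then have "singular_face 2 0 (triangle F a b c) = loop_simplex (\<lambda>t. F (linepath b c t))"
       "singular_face 2 1 (triangle F a b c) = loop_simplex (\<lambda>t. F (linepath a c t))"
       "singular_face 2 2 (triangle F a b c) = loop_simplex (\<lambda>t. F (linepath a b t))"
    by (auto simp: fun_eq_iff singular_face_def loop_simplex_def restrict_def)
  then show ?thesis
    by (simp add: path_chain_def chain_boundary_of sum_atMost_2)
qed

text \<open>The inverse of \<^const>\<open>loop_simplex\<close>, by evaluation at the point with barycentric
  coordinates \<open>1 - t\<close> and \<open>t\<close>.\<close>

definition simplex_path :: "((nat \<Rightarrow> real) \<Rightarrow> 'a) \<Rightarrow> real \<Rightarrow> 'a" where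
  "simplex_path \<sigma> t = \<sigma> (\<lambda>i. if i = 0 then 1 - t else if i = 1 then t else 0)"

lemma simplex_path_loop_simplex: "0 \<le> t \<Longrightarrow> t \<le> 1 \<Longrightarrow> simplex_path (loop_simplex f) t = f t"
  by (simp add: simplex_path_def loop_simplex_def standard_simplex_1_iff)

lemma loop_simplex_simplex_path:
  assumes "\<sigma> \<in> extensional (standard_simplex 1)"
  shows "loop_simplex (simplex_path \<sigma>) = \<sigma>"
proof
  fix v
  have "(\<lambda>i. if i = 0 then 1 - v (Suc 0) else if i = 1 then v (Suc 0) else 0) = v" if "v \<in> standard_simplex 1"
    using that by (auto simp: standard_simplex_1_iff fun_eq_iff)
  then show "loop_simplex (simplex_path \<sigma>) v = \<sigma> v"
    using assms by (auto simp: loop_simplex_def simplex_path_def extensional_def)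
qed

lemma singular_1_simplices: "cl_singular_simplices 1 X = loop_simplex ` {f. cl_map {0..1} X f}"
proof (intro equalityI subsetI)
  fix \<sigma> assume \<sigma>: "\<sigma> \<in> cl_singular_simplices 1 X"
  define e where "e = (\<lambda>(t::real) (i::nat). if i = 0 then 1 - t else if i = 1 then t else 0)"
  have "continuous_on {0..1} (\<lambda>z. e z i)" for i
    unfolding e_def by (cases "i = 0"; cases "i = 1") (auto intro!: continuous_intros)
  then have "continuous_on {0..1} e"
    by (rule continuous_on_coordinatewise_then_product)
  moreover have "e ` {0..1} \<subseteq> standard_simplex 1"
    by (auto simp: e_def standard_simplex_1_iff)
  ultimately have "cl_map {0..1} X (simplex_path \<sigma>)"
    using cl_map_compose[of "standard_simplex 1" X \<sigma> "{0..1}" e] \<sigma>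
    by (simp add: cl_singular_simplices_iff simplex_path_def[abs_def] e_def)
  moreover have "loop_simplex (simplex_path \<sigma>) = \<sigma>"
    using \<sigma> loop_simplex_simplex_path unfolding cl_singular_simplices_iff by blast
  ultimately show "\<sigma> \<in> loop_simplex ` {f. cl_map {0..1} X f}"
    by (metis (mono_tags) image_eqI mem_Collect_eq)
next
  fix \<sigma> assume "\<sigma> \<in> loop_simplex ` {f. cl_map {0..1} X f}"
  then obtain f where f: "cl_map {0..1} X f" and \<sigma>: "\<sigma> = loop_simplex f" by blast
  have "cl_map (standard_simplex 1) X (\<lambda>v. f (v 1))"
    by (rule cl_map_compose[OF f])
       (auto simp: standard_simplex_1_iff intro: continuous_on_subset[OF continuous_on_product_coordinates])
  then show "\<sigma> \<in> cl_singular_simplices 1 X"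
    using cl_map_cong[of "standard_simplex 1" \<sigma> "\<lambda>v. f (v 1)" X]
    by (simp add: \<sigma> cl_singular_simplices_iff loop_simplex_def)
qed

lemma triangle_singular:
  fixes F :: "'b::real_normed_vector \<Rightarrow> 'a"
  assumes F: "cl_map K X F" and K: "convex K" and abc: "a \<in> K" "b \<in> K" "c \<in> K"
  shows "triangle F a b c \<in> cl_singular_simplices 2 X"
proof -
  have coord: "continuous_on (standard_simplex 2) (\<lambda>v::nat \<Rightarrow> real. v i)" for i
    by (rule continuous_on_subset[OF continuous_on_product_coordinates]) simp
  have "v 0 *\<^sub>R a + v 1 *\<^sub>R b + v 2 *\<^sub>R c \<in> K" if v: "v \<in> standard_simplex 2" for v
  proof -
    have "(\<Sum>i\<le>2. v i *\<^sub>R (if i = 0 then a else if i = 1 then b else c)) \<in> K"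
      using v K abc by (intro convex_sum) (auto simp: standard_simplex_def)
    then show ?thesis by (simp add: sum_atMost_2)
  qed
  then have "cl_map (standard_simplex 2) X (\<lambda>v. F (v 0 *\<^sub>R a + v 1 *\<^sub>R b + v 2 *\<^sub>R c))"
    by (intro cl_map_compose[OF F] continuous_intros coord) auto
  then show ?thesis
    using cl_map_cong[of "standard_simplex 2" "triangle F a b c"
        "\<lambda>v. F (v 0 *\<^sub>R a + v 1 *\<^sub>R b + v 2 *\<^sub>R c)" X]
    by (simp add: cl_singular_simplices_iff triangle_def)
qed

text \<open>Conversely, every singular 2-simplex is a \<^const>\<open>triangle\<close>, after reading coordinates \<open>1\<close>
  and \<open>2\<close> as a point of the plane.\<close>

definition plane_triangle :: "(real \<times> real) set" where
  "plane_triangle = {z. 0 \<le> fst z \<and> 0 \<le> snd z \<and> fst z + snd z \<le> 1}"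

lemma convex_plane_triangle: "convex plane_triangle"
proof -
  have "plane_triangle = {z. 0 \<le> fst z} \<inter> {z. 0 \<le> snd z} \<inter> {z. fst z + snd z \<le> 1}"
    by (auto simp: plane_triangle_def)
  moreover have "convex {z::real\<times>real. 0 \<le> fst z}" "convex {z::real\<times>real. 0 \<le> snd z}"
    by (auto simp: convex_def)
  moreover have "convex {z::real\<times>real. fst z + snd z \<le> 1}"
    using convex_halfspace_le[of "(1, 1) :: real \<times> real" 1] by (simp add: inner_prod_def)
  ultimately show ?thesis
    by (metis convex_Int)
qed

lemma singular_2_simplex_as_triangle:
  assumes \<tau>: "\<tau> \<in> cl_singular_simplices 2 X"
  obtains F where "cl_map plane_triangle X F" "\<tau> = triangle F (0, 0) (1, 0) (0, 1)"
proof
  define e where "e = (\<lambda>(z::real \<times> real) (i::nat). if i = 0 then 1 - fst z - snd z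
                        else if i = 1 then fst z else if i = 2 then snd z else 0)"
  have "continuous_on plane_triangle (\<lambda>z. e z i)" for i
    unfolding e_def by (cases "i = 0"; cases "i = 1"; cases "i = 2") (auto intro!: continuous_intros)
  then have "continuous_on plane_triangle e"
    by (rule continuous_on_coordinatewise_then_product)
  moreover have "e ` plane_triangle \<subseteq> standard_simplex 2"
    by (auto simp: e_def standard_simplex_2_iff plane_triangle_def)
  ultimately show "cl_map plane_triangle X (\<lambda>z. \<tau> (e z))"
    using cl_map_compose[of "standard_simplex 2" X \<tau> plane_triangle e] \<tau>
    by (simp add: cl_singular_simplices_iff)
  show "\<tau> = triangle (\<lambda>z. \<tau> (e z)) (0, 0) (1, 0) (0, 1)"
  proof
    fix v
    have "e (v 1, v 2) = v" if "v \<in> standard_simplex 2"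
      using that by (auto simp: e_def standard_simplex_2_iff fun_eq_iff)
    then show "\<tau> v = triangle (\<lambda>z. \<tau> (e z)) (0, 0) (1, 0) (0, 1) v"
      using \<tau> by (auto simp: triangle_def cl_singular_simplices_iff extensional_def)
  qed
qed

section \<open>First homology\<close>

lemma cl_boundaries_1:
  fixes X :: "'a cl_space"
  shows "cl_boundaries 1 X = chain_boundary 2 ` {c. Poly_Mapping.keys c \<subseteq> cl_singular_simplices 2 X}"
proof -
  have "carrier (free_Abelian_group S) = {c. Poly_Mapping.keys c \<subseteq> S}" for S :: "((nat \<Rightarrow> real) \<Rightarrow> 'a) set"
    by auto
  then show ?thesis
    by (simp add: cl_boundaries_def cl_chain_group_def numeral_2_eq_2)
qed

lemma cl_cycles_1: "c \<in> carrier (cl_cycle_group 1 X) \<longleftrightarrow>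
    Poly_Mapping.keys c \<subseteq> cl_singular_simplices 1 X \<and> chain_boundary 1 c = 0"
  by (simp add: cl_cycle_group_def cl_chain_group_def)

lemma zero_in_boundaries: "0 \<in> cl_boundaries 1 X"
  unfolding cl_boundaries_1 by (rule image_eqI[of _ _ 0]) auto

lemma diff_in_boundaries:
  assumes "b \<in> cl_boundaries 1 X" "c \<in> cl_boundaries 1 X"
  shows "b - c \<in> cl_boundaries 1 X"
proof -
  obtain b' c' where keys: "Poly_Mapping.keys b' \<subseteq> cl_singular_simplices 2 X"
      "Poly_Mapping.keys c' \<subseteq> cl_singular_simplices 2 X"
    and bc: "b = chain_boundary 2 b'" "c = chain_boundary 2 c'"
    using assms unfolding cl_boundaries_1 by blast
  have "Poly_Mapping.keys (b' - c') \<subseteq> cl_singular_simplices 2 X"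
    using keys keys_diff[of b' c'] by blast
  moreover have "b - c = chain_boundary 2 (b' - c')"
    by (simp add: bc chain_boundary_diff)
  ultimately show ?thesis
    unfolding cl_boundaries_1 by blast
qed

lemma minus_in_boundaries: "b \<in> cl_boundaries 1 X \<Longrightarrow> - b \<in> cl_boundaries 1 X"
  using diff_in_boundaries[OF zero_in_boundaries, of b] by simp

lemma add_in_boundaries:
  "b \<in> cl_boundaries 1 X \<Longrightarrow> c \<in> cl_boundaries 1 X \<Longrightarrow> b + c \<in> cl_boundaries 1 X"
  using diff_in_boundaries[OF _ minus_in_boundaries, of b X c] by simp

lemma path_chain_in_chains:
  "cl_map {0..1} X f \<Longrightarrow> Poly_Mapping.keys (path_chain f) \<subseteq> cl_singular_simplices 1 X"
  unfolding singular_1_simplices path_chain_def by auto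

text \<open>Linearity reduces statements about boundaries to single triangles.\<close>

lemma boundaries_induct [consumes 1, case_names zero triangle diff]:
  fixes P :: "'a chain \<Rightarrow> bool"
  assumes "d \<in> cl_boundaries 1 X" and "P 0"
    and tri: "\<And>F. cl_map plane_triangle X F \<Longrightarrow>
       P (path_chain (\<lambda>t. F (linepath (1, 0) (0, 1) t)) - path_chain (\<lambda>t. F (linepath (0, 0) (0, 1) t))
          + path_chain (\<lambda>t. F (linepath (0, 0) (1, 0) t)))"
    and diff: "\<And>a b. a \<in> cl_boundaries 1 X \<Longrightarrow> b \<in> cl_boundaries 1 X \<Longrightarrow> P a \<Longrightarrow> P b \<Longrightarrow> P (a - b)"
  shows "P d"
proof -
  obtain c where c: "Poly_Mapping.keys c \<subseteq> cl_singular_simplices 2 X" and d: "d = chain_boundary 2 c"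
    using assms(1) unfolding cl_boundaries_1 by blast
  have mem: "chain_boundary 2 c \<in> cl_boundaries 1 X"
    if "Poly_Mapping.keys c \<subseteq> cl_singular_simplices 2 X" for c
    using that unfolding cl_boundaries_1 by blast
  have "P (chain_boundary 2 c)"
    using c
  proof (induction c rule: free_Abelian_group_induct[consumes 1, case_names zero diff one])
    case zero
    show ?case using \<open>P 0\<close> by simp
  next
    case (diff x y)
    then show ?case
      using assms(4) mem by (simp add: chain_boundary_diff)
  next
    case (one \<tau>)
    then obtain F where "cl_map plane_triangle X F" "\<tau> = triangle F (0, 0) (1, 0) (0, 1)"
      by (rule singular_2_simplex_as_triangle)
    then show ?case
      using tri[of F] by (simp add: boundary_triangle)
  qed
  then show ?thesis by (simp add: d)
qed

lemma mem_plane_triangle: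
  "(0, 0) \<in> plane_triangle" "(1, 0) \<in> plane_triangle" "(0, 1) \<in> plane_triangle"
  by (simp_all add: plane_triangle_def)

lemma cl_map_linepath:
  fixes F :: "'b::real_normed_vector \<Rightarrow> 'a"
  assumes "cl_map K X F" "convex K" "a \<in> K" "b \<in> K"
  shows "cl_path X (F a) (F b) (\<lambda>t. F (linepath a b t))"
proof -
  have "linepath a b ` {0..1} \<subseteq> K"
    using closed_segment_subset[of a K b] assms by (simp add: linepath_image_01)
  then have "cl_map {0..1} X (\<lambda>t. F (linepath a b t))"
    by (intro cl_map_compose[OF assms(1)]) (auto intro: continuous_on_linepath)
  then show ?thesis
    by (simp add: cl_path_def linepath_0' linepath_1')
qed

lemma boundaries_subset_cycles: "cl_boundaries 1 X \<subseteq> carrier (cl_cycle_group 1 X)"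
proof
  fix d assume "d \<in> cl_boundaries 1 X"
  then show "d \<in> carrier (cl_cycle_group 1 X)"
  proof (induction rule: boundaries_induct)
    case (triangle F)
    have "cl_path X (F a) (F b) (\<lambda>t. F (linepath a b t))" if "a \<in> plane_triangle" "b \<in> plane_triangle" for a b
      using cl_map_linepath[OF triangle convex_plane_triangle that] .
    then have keys: "Poly_Mapping.keys (path_chain (\<lambda>t. F (linepath a b t))) \<subseteq> cl_singular_simplices 1 X"
      if "a \<in> plane_triangle" "b \<in> plane_triangle" for a b
      using that path_chain_in_chains unfolding cl_path_def by blast
    show ?case
      unfolding cl_cycles_1
      using keys[OF mem_plane_triangle(2,3)] keys[OF mem_plane_triangle(1,3)]
        keys[OF mem_plane_triangle(1,2)]
      by (simp add: chain_boundary_add chain_boundary_diff boundary_path_chain[unfolded One_nat_def]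
          linepath_0' linepath_1')
         (blast dest: subsetD[OF keys_add] subsetD[OF keys_diff])
  next
    case (diff a b)
    then show ?case
      unfolding cl_cycles_1 chain_boundary_diff using keys_diff[of a b] by auto
  qed (simp add: cl_cycles_1[unfolded One_nat_def])
qed

lemma subgroup_cycles: "subgroup (carrier (cl_cycle_group 1 X)) (cl_chain_group 1 X)"
  unfolding cl_chain_group_def
proof (rule group.subgroupI)
  show "carrier (cl_cycle_group 1 X) \<noteq> {}"
    using zero_in_boundaries boundaries_subset_cycles by blast
next
  fix a b assume "a \<in> carrier (cl_cycle_group 1 X)" "b \<in> carrier (cl_cycle_group 1 X)"
  then show "a \<otimes>\<^bsub>free_Abelian_group (cl_singular_simplices 1 X)\<^esub> b \<in> carrier (cl_cycle_group 1 X)"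
    unfolding cl_cycles_1 mult_free_Abelian_group chain_boundary_add using keys_add[of a b] by auto
qed (auto simp: cl_cycles_1[unfolded One_nat_def] chain_boundary_minus)

lemma subgroup_boundaries: "subgroup (cl_boundaries 1 X) (cl_chain_group 1 X)"
  unfolding cl_chain_group_def
proof (rule group.subgroupI)
  have sub: "Poly_Mapping.keys c \<subseteq> cl_singular_simplices 1 X" if "c \<in> cl_boundaries 1 X" for c
    using that boundaries_subset_cycles cl_cycles_1 by blast
  then show "cl_boundaries 1 X \<subseteq> carrier (free_Abelian_group (cl_singular_simplices 1 X))"
    by auto
  show "cl_boundaries 1 X \<noteq> {}" using zero_in_boundaries by blast
  fix a b assume a: "a \<in> cl_boundaries 1 X"
  then show "inv\<^bsub>free_Abelian_group (cl_singular_simplices 1 X)\<^esub> a \<in> cl_boundaries 1 X"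
    using sub minus_in_boundaries by simp
  assume "b \<in> cl_boundaries 1 X"
  with a show "a \<otimes>\<^bsub>free_Abelian_group (cl_singular_simplices 1 X)\<^esub> b \<in> cl_boundaries 1 X"
    unfolding mult_free_Abelian_group by (rule add_in_boundaries)
qed simp

lemma mult_cl_cycle_group: "a \<otimes>\<^bsub>cl_cycle_group n X\<^esub> b = a + b"
  by (simp add: cl_cycle_group_def cl_chain_group_def)

lemma cl_cycle_group_eq:
  "cl_cycle_group n X = (cl_chain_group n X)\<lparr>carrier := carrier (cl_cycle_group n X)\<rparr>"
  by (simp add: cl_cycle_group_def)

lemma group_chain_group: "group (cl_chain_group n X)"
  by (simp add: cl_chain_group_def)

lemma comm_group_cycles: "comm_group (cl_cycle_group 1 X)"
proof (rule group.group_comm_groupI)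
  show "group (cl_cycle_group 1 X)"
    using group.subgroup_imp_group[OF group_chain_group subgroup_cycles] cl_cycle_group_eq by metis
qed (simp add: mult_cl_cycle_group add.commute)

lemma normal_boundaries: "cl_boundaries 1 X \<lhd> cl_cycle_group 1 X"
proof -
  have "subgroup (cl_boundaries 1 X) (cl_cycle_group 1 X)"
    using group.subgroup_incl[OF group_chain_group subgroup_boundaries subgroup_cycles
        boundaries_subset_cycles] cl_cycle_group_eq by metis
  then show ?thesis
    using comm_group.normal_iff_subgroup[OF comm_group_cycles] by blast
qed

lemma comm_group_homology: "comm_group (cl_homology_group 1 X)"
  unfolding cl_homology_group_def
  by (intro comm_group.abelian_FactGroup comm_group_cycles normal_imp_subgroup normal_boundaries)

lemma carrier_homology:
  "carrier (cl_homology_group 1 X) = cl_homology_class 1 X ` carrier (cl_cycle_group 1 X)"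
  by (simp add: cl_homology_group_def carrier_FactGroup cl_homology_class_def)

lemma mult_homology_class:
  assumes "c \<in> carrier (cl_cycle_group 1 X)" "d \<in> carrier (cl_cycle_group 1 X)"
  shows "cl_homology_class 1 X c \<otimes>\<^bsub>cl_homology_group 1 X\<^esub> cl_homology_class 1 X d =
    cl_homology_class 1 X (c + d)"
  using normal.rcos_sum[OF normal_boundaries assms]
  by (simp add: cl_homology_group_def cl_homology_class_def mult_cl_cycle_group)

lemma one_homology: "\<one>\<^bsub>cl_homology_group 1 X\<^esub> = cl_homology_class 1 X 0"
  by (auto simp: cl_homology_group_def cl_homology_class_def r_coset_def mult_cl_cycle_group)

lemma homology_class_eq_iff:
  "cl_homology_class 1 X c = cl_homology_class 1 X d \<longleftrightarrow> c - d \<in> cl_boundaries 1 X"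
proof
  assume "cl_homology_class 1 X c = cl_homology_class 1 X d"
  moreover have "c \<in> cl_homology_class 1 X c"
    using zero_in_boundaries[of X]
    by (force simp: cl_homology_class_def r_coset_def mult_cl_cycle_group)
  ultimately obtain b where "b \<in> cl_boundaries 1 X" "c = b + d"
    by (auto simp: cl_homology_class_def r_coset_def mult_cl_cycle_group)
  then show "c - d \<in> cl_boundaries 1 X" by simp
next
  have sub: "cl_homology_class 1 X c \<subseteq> cl_homology_class 1 X d"
    if "c - d \<in> cl_boundaries 1 X" for c d
  proof
    fix z assume "z \<in> cl_homology_class 1 X c"
    then obtain b where "b \<in> cl_boundaries 1 X" "z = b + c"
      by (auto simp: cl_homology_class_def r_coset_def mult_cl_cycle_group)
    with that have "b + (c - d) \<in> cl_boundaries 1 X"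
      by (intro add_in_boundaries)
    moreover have "z = (b + (c - d)) + d"
      using \<open>z = b + c\<close> by simp
    ultimately show "z \<in> cl_homology_class 1 X d"
      unfolding cl_homology_class_def r_coset_def mult_cl_cycle_group by blast
  qed
  assume "c - d \<in> cl_boundaries 1 X"
  then show "cl_homology_class 1 X c = cl_homology_class 1 X d"
    using sub[of c d] sub[of d c] minus_in_boundaries[of "c - d" X] by auto
qed

section \<open>Homologous chains of paths\<close>

context closure_space
begin

text \<open>The source of all homologies between paths.\<close>

lemma triangle_homologous:
  fixes F :: "'b::real_normed_vector \<Rightarrow> 'a"
  assumes "cl_map K X F" "convex K" "a \<in> K" "b \<in> K" "c \<in> K"
  shows "path_chain (\<lambda>t. F (linepath b c t)) - path_chain (\<lambda>t. F (linepath a c t))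
       + path_chain (\<lambda>t. F (linepath a b t)) \<in> cl_boundaries 1 X"
  unfolding boundary_triangle[symmetric] cl_boundaries_1
  using triangle_singular[OF assms] by (intro imageI) simp

text \<open>The constant triangle has three equal sides, of which two cancel in its boundary.\<close>

lemma const_homologous:
  assumes "x \<in> points X"
  shows "path_chain (\<lambda>_. x) \<in> cl_boundaries 1 X"
  using triangle_homologous[OF cl_map_const[OF assms] convex_UNIV, of "0::real" 0 0] by simp

text \<open>The diagonal cuts the square into two triangles; the diagonal itself cancels, and the
  vertical sides are constant.\<close>

lemma homotopic_homologous:
  assumes "path_homotopic X f g"
  shows "path_chain f - path_chain g \<in> cl_boundaries 1 X"
proof -
  obtain H where H: "cl_map unit_square X H"
    and H': "\<And>s. 0 \<le> s \<Longrightarrow> s \<le> 1 \<Longrightarrow> H (s, 0) = f s" "\<And>s. 0 \<le> s \<Longrightarrow> s \<le> 1 \<Longrightarrow> H (s, 1) = g s"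
      "\<And>t. 0 \<le> t \<Longrightarrow> t \<le> 1 \<Longrightarrow> H (0, t) = f 0" "\<And>t. 0 \<le> t \<Longrightarrow> t \<le> 1 \<Longrightarrow> H (1, t) = f 1"
    using assms by (rule path_homotopicE) (rule that)
  have pts: "f 0 \<in> points X" "f 1 \<in> points X"
    using cl_map_in_points[OF H, of "(0, 0)"] cl_map_in_points[OF H, of "(1, 0)"] by (simp_all add: H')
  have conv: "convex unit_square" by (intro convex_Times convex_real_interval)
  let ?d = "path_chain (\<lambda>t. H (linepath (0, 0) (1, 1) t))"
  have "path_chain (\<lambda>t. H (linepath (1, 0) (1, 1) t)) - ?d
      + path_chain (\<lambda>t. H (linepath (0, 0) (1, 0) t)) \<in> cl_boundaries 1 X"
    by (rule triangle_homologous[OF H conv]) simp_all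
  moreover have "path_chain (\<lambda>t. H (linepath (1, 0) (1, 1) t)) = path_chain (\<lambda>_. f 1)"
    "path_chain (\<lambda>t. H (linepath (0, 0) (1, 0) t)) = path_chain f"
    by (rule path_chain_cong; simp add: linepath_def H')+
  ultimately have 1: "path_chain (\<lambda>_. f 1) - ?d + path_chain f \<in> cl_boundaries 1 X" by simp
  have "path_chain (\<lambda>t. H (linepath (0, 1) (1, 1) t)) - ?d
      + path_chain (\<lambda>t. H (linepath (0, 0) (0, 1) t)) \<in> cl_boundaries 1 X"
    by (rule triangle_homologous[OF H conv]) simp_all
  moreover have "path_chain (\<lambda>t. H (linepath (0, 1) (1, 1) t)) = path_chain g"
    "path_chain (\<lambda>t. H (linepath (0, 0) (0, 1) t)) = path_chain (\<lambda>_. f 0)"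
    by (rule path_chain_cong; simp add: linepath_def H')+
  ultimately have 2: "path_chain g - ?d + path_chain (\<lambda>_. f 0) \<in> cl_boundaries 1 X" by simp
  have "(path_chain (\<lambda>_. f 1) - ?d + path_chain f) - (path_chain g - ?d + path_chain (\<lambda>_. f 0))
      - path_chain (\<lambda>_. f 1) + path_chain (\<lambda>_. f 0) \<in> cl_boundaries 1 X"
    by (intro add_in_boundaries diff_in_boundaries 1 2 const_homologous pts)
  then show ?thesis by (simp add: algebra_simps)
qed

text \<open>Lay \<open>f\<close> and \<open>g\<close> end to end on \<open>[0, 2]\<close> and take the degenerate triangle with vertices
  \<open>0, 1, 2\<close>. Its long side runs through \<open>[0, 2]\<close> at double speed, which is the concatenation.\<close>

lemma concat_homologous:
  assumes "cl_path X x y f" "cl_path X y z g"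
  shows "path_chain f + path_chain g - path_chain (loop_concat f g) \<in> cl_boundaries 1 X"
proof -
  have f: "cl_map {0..1} X f" and g: "cl_map {0..1} X g" and eq: "f 1 = g 0"
    using assms by (auto simp: cl_path_def)
  define F where "F = (\<lambda>t::real. if t \<le> 1 then f t else g (t - 1))"
  have g': "cl_map {1..2} X (\<lambda>t. g (t - 1))"
    by (rule cl_map_compose[OF g]) (auto intro!: continuous_intros)
  have "cl_map ({0..1} \<union> {1..2}) X F"
    by (rule cl_map_paste[OF f g']) (use eq in \<open>force simp: F_def\<close>)+
  moreover have "{0..1} \<union> {1..2} = {0..2::real}" by auto
  ultimately have F: "cl_map {0..2} X F" by simp
  have "path_chain (\<lambda>t. F (linepath 1 2 t)) - path_chain (\<lambda>t. F (linepath 0 2 t))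
      + path_chain (\<lambda>t. F (linepath 0 1 t)) \<in> cl_boundaries 1 X"
    by (rule triangle_homologous[OF F]) simp_all
  moreover have "path_chain (\<lambda>t. F (linepath 1 2 t)) = path_chain g"
    by (rule path_chain_cong) (use eq in \<open>auto simp: F_def linepath_def algebra_simps\<close>)
  moreover have "path_chain (\<lambda>t. F (linepath 0 1 t)) = path_chain f"
    by (rule path_chain_cong) (simp add: F_def linepath_def)
  moreover have "path_chain (\<lambda>t. F (linepath 0 2 t)) = path_chain (loop_concat f g)"
    by (rule path_chain_cong) (simp add: F_def linepath_def loop_concat_def mult.commute)
  ultimately show ?thesis by (simp add: algebra_simps)
qed

lemma reverse_homologous:
  assumes "cl_path X x y f"
  shows "path_chain (path_reverse f) + path_chain f \<in> cl_boundaries 1 X"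
proof -
  let ?r = "path_reverse f"
  have "y \<in> points X"
    using assms cl_map_in_points[of "{0..1}" X f 1] by (auto simp: cl_path_def)
  then have "(path_chain ?r + path_chain f - path_chain (loop_concat ?r f))
      + ((path_chain (loop_concat ?r f) - path_chain (\<lambda>_. y)) + path_chain (\<lambda>_. y)) \<in> cl_boundaries 1 X"
    using concat_homologous[OF cl_path_reverse[OF assms] assms]
      homotopic_homologous[OF path_homotopic_reverse_left[OF assms]] const_homologous[of y]
    by (intro add_in_boundaries)
  then show ?thesis by simp
qed

end

section \<open>The Hurewicz homomorphism\<close>

lemma (in group_hom) derived_in_kernel:
  assumes "comm_group H"
  shows "derived G (carrier G) \<subseteq> kernel G H h"
proof -
  interpret H: comm_group H by (rule assms)
  have "x \<otimes> y \<otimes> inv x \<otimes> inv y \<in> kernel G H h" if xy: "x \<in> carrier G" "y \<in> carrier G" for x y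
  proof -
    have "h x \<otimes>\<^bsub>H\<^esub> h y \<otimes>\<^bsub>H\<^esub> inv\<^bsub>H\<^esub> h x = h y"
      using xy by (metis hom_closed inv_closed hom_inv H.inv_solve_right H.m_closed H.m_comm)
    then show ?thesis
      using xy by (simp add: kernel_def)
  qed
  then show ?thesis
    unfolding derived_def by (intro G.generate_subgroup_incl subgroup_kernel) auto
qed

context pointed_closure_space
begin

lemma loop_cycle:
  assumes "f \<in> cl_loops X x0"
  shows "path_chain f \<in> carrier (cl_cycle_group 1 X)"
proof -
  have "cl_map {0..1} X f" "f 0 = x0" "f 1 = x0"
    using assms by (auto simp: cl_loops_iff cl_path_def)
  then show ?thesis
    using path_chain_in_chains unfolding cl_cycles_1 boundary_path_chain by simp
qed

lemma hurewicz_loop_class: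
  assumes f: "f \<in> cl_loops X x0"
  shows "hurewicz X (loop_class X x0 f) = cl_homology_class 1 X (path_chain f)"
proof -
  have "cl_homology_class 1 X (path_chain g) = cl_homology_class 1 X (path_chain f)"
    if "g \<in> loop_class X x0 f" for g
    using that f homotopic_homologous[of g f] path_homotopic_sym[of X f g]
    by (simp add: mem_loop_class_iff homology_class_eq_iff[unfolded One_nat_def])
  then show ?thesis
    using loop_class_self[OF f] unfolding hurewicz_def path_chain_def by blast
qed

lemma hurewicz_hom: "hurewicz X \<in> hom (fundamental_group X x0) (cl_homology_group 1 X)"
proof (rule homI)
  fix a assume "a \<in> carrier (fundamental_group X x0)"
  then obtain f where f: "f \<in> cl_loops X x0" and a: "a = loop_class X x0 f"
    by (auto simp: carrier_fundamental_group)
  show "hurewicz X a \<in> carrier (cl_homology_group 1 X)"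
    unfolding a hurewicz_loop_class[OF f] carrier_homology using loop_cycle[OF f] by (rule imageI)
  fix b assume "b \<in> carrier (fundamental_group X x0)"
  then obtain g where g: "g \<in> cl_loops X x0" and b: "b = loop_class X x0 g"
    by (auto simp: carrier_fundamental_group)
  have fg: "cl_path X x0 x0 f" "cl_path X x0 x0 g"
    using f g by (simp_all add: cl_loops_iff)
  have "hurewicz X (a \<otimes>\<^bsub>fundamental_group X x0\<^esub> b) = cl_homology_class 1 X (path_chain (loop_concat f g))"
    unfolding a b mult_fundamental_group[OF f g]
    by (rule hurewicz_loop_class[OF loop_concat_in_cl_loops[OF fg]])
  also have "\<dots> = cl_homology_class 1 X (path_chain f + path_chain g)"
    using concat_homologous[OF fg] by (intro sym[OF homology_class_eq_iff[THEN iffD2]])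
  also have "\<dots> = hurewicz X a \<otimes>\<^bsub>cl_homology_group 1 X\<^esub> hurewicz X b"
    unfolding a b hurewicz_loop_class[OF f] hurewicz_loop_class[OF g]
    by (rule mult_homology_class[OF loop_cycle[OF f] loop_cycle[OF g], symmetric])
  finally show "hurewicz X (a \<otimes>\<^bsub>fundamental_group X x0\<^esub> b)
      = hurewicz X a \<otimes>\<^bsub>cl_homology_group 1 X\<^esub> hurewicz X b" .
qed

lemma group_hom_hurewicz:
  "group_hom (fundamental_group X x0) (cl_homology_group 1 X) (hurewicz X)"
  unfolding group_hom_def group_hom_axioms_def
  using group_fundamental_group comm_group.axioms(2)[OF comm_group_homology] hurewicz_hom by blast

end

section \<open>Closing up paths to loops\<close>

text \<open>The path to the base point itself is constant so that closing up a loop at \<open>x0\<close> does not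
  change its class (\<open>based_loop_of_loop\<close>).\<close>

locale closure_space_with_base_paths = pointed_closure_space X x0
  for X :: "'a cl_space" and x0 +
  fixes \<gamma> :: "'a \<Rightarrow> real \<Rightarrow> 'a"
  assumes base_path: "x \<in> points X \<Longrightarrow> cl_path X x0 x (\<gamma> x)"
    and base_path_base_point: "\<gamma> x0 = (\<lambda>_. x0)"
begin

definition based_loop :: "(real \<Rightarrow> 'a) \<Rightarrow> real \<Rightarrow> 'a" where
  "based_loop f = loop_concat (loop_concat (\<gamma> (f 0)) f) (path_reverse (\<gamma> (f 1)))"

lemma based_loop_cong:
  assumes "\<And>t. 0 \<le> t \<Longrightarrow> t \<le> 1 \<Longrightarrow> f t = g t"
  shows "based_loop f = based_loop g"
  using assms by (auto simp: based_loop_def loop_concat_def fun_eq_iff restrict_def)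

lemma base_path_reverse: "x \<in> points X \<Longrightarrow> cl_path X x x0 (path_reverse (\<gamma> x))"
  by (intro cl_path_reverse base_path)

lemma based_loop_in_loops:
  assumes "cl_path X x y f"
  shows "based_loop f \<in> cl_loops X x0"
proof -
  have "f 0 = x" "f 1 = y" using assms by (auto simp: cl_path_def)
  then show ?thesis
    unfolding based_loop_def
    using cl_path_in_points[OF assms] assms
    by (metis base_path base_path_reverse cl_path_concat loop_concat_in_cl_loops)
qed

lemma based_loop_of_loop:
  assumes f: "f \<in> cl_loops X x0"
  shows "path_homotopic X (based_loop f) f"
proof -
  have p: "cl_path X x0 x0 f" and ends: "f 0 = x0" "f 1 = x0"
    using f by (auto simp: cl_loops_iff cl_path_def)
  have "path_homotopic X (loop_concat (loop_concat (\<lambda>_. x0) f) (\<lambda>_. x0)) (loop_concat (\<lambda>_. x0) f)"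
    by (rule path_homotopic_const_right[OF cl_path_concat[OF cl_path_const[OF base_point] p]])
  then have "path_homotopic X (loop_concat (loop_concat (\<lambda>_. x0) f) (\<lambda>_. x0)) f"
    using path_homotopic_const_left[OF p] by (rule path_homotopic_trans)
  then show ?thesis
    by (simp add: based_loop_def ends base_path_base_point path_reverse_def)
qed

text \<open>Up to homotopy \<open>based_loop\<close> respects concatenation: the tail of the first loop cancels
  against the head of the second.\<close>

lemma based_loop_concat:
  assumes f: "cl_path X x y f" and g: "cl_path X y z g" and h: "path_homotopic X (loop_concat f g) h"
  shows "path_homotopic X (loop_concat (based_loop f) (based_loop g)) (based_loop h)"
proof -
  have pts: "x \<in> points X" "y \<in> points X" "z \<in> points X"
    using cl_path_in_points[OF f] cl_path_in_points[OF g] by blast+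
  have ends: "f 0 = x" "f 1 = y" "g 0 = y" "g 1 = z"
    using f g by (auto simp: cl_path_def)
  have hends: "h 0 = x" "h 1 = z"
    using path_homotopic_ends[OF h] ends by (auto simp: loop_concat_def)
  define p q q' r' where "p = \<gamma> x" "q = \<gamma> y" "q' = path_reverse (\<gamma> y)" "r' = path_reverse (\<gamma> z)"
  have p: "cl_path X x0 x p" and q: "cl_path X x0 y q" and q': "cl_path X y x0 q'"
    and r': "cl_path X z x0 r'"
    unfolding p_q_q'_r'_def using pts base_path base_path_reverse by blast+
  have refl: "path_homotopic X k k" if "cl_path X a b k" for a b k
    using that by (simp add: cl_path_def path_homotopic_refl)
  note [trans] = path_homotopic_trans
  note pf = cl_path_concat[OF p f] and qg = cl_path_concat[OF q g]
  note fg = cl_path_concat[OF f g] and q'q = cl_path_concat[OF q' q]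
  \<comment> \<open>\<open>q' (q g) \<simeq> (q' q) g \<simeq> g\<close>\<close>
  have 1: "path_homotopic X (loop_concat q' (loop_concat q g)) g"
  proof -
    have "path_homotopic X (loop_concat q' (loop_concat q g)) (loop_concat (loop_concat q' q) g)"
      by (rule path_homotopic_sym[OF path_homotopic_assoc[OF q' q g]])
    moreover have "path_homotopic X (loop_concat (loop_concat q' q) g) (loop_concat (\<lambda>_. y) g)"
    proof (rule path_homotopic_concat[OF _ refl[OF g]])
      show "path_homotopic X (loop_concat q' q) (\<lambda>_. y)"
        using path_homotopic_reverse_left[OF q] by (simp add: p_q_q'_r'_def)
      show "loop_concat q' q 1 = g 0"
        using q'q by (simp add: cl_path_def ends)
    qed
    ultimately show ?thesis
      using path_homotopic_const_left[OF g] path_homotopic_trans by blast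
  qed
  have "path_homotopic X (loop_concat (loop_concat (loop_concat p f) q') (loop_concat (loop_concat q g) r'))
      (loop_concat (loop_concat p f) (loop_concat q' (loop_concat (loop_concat q g) r')))"
    by (rule path_homotopic_assoc[OF pf q' cl_path_concat[OF qg r']])
  also have "path_homotopic X \<dots>
      (loop_concat (loop_concat p f) (loop_concat (loop_concat q' (loop_concat q g)) r'))"
    by (rule path_homotopic_concat[OF refl[OF pf] path_homotopic_sym[OF path_homotopic_assoc[OF q' qg r']]])
       (use pf q' in \<open>simp add: cl_path_def loop_concat_def\<close>)
  also have "path_homotopic X \<dots> (loop_concat (loop_concat p f) (loop_concat g r'))"
  proof (rule path_homotopic_concat[OF refl[OF pf] path_homotopic_concat[OF 1 refl[OF r']]])
    show "loop_concat q' (loop_concat q g) 1 = r' 0"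
      using cl_path_concat[OF q' qg] r' by (simp add: cl_path_def)
    show "loop_concat p f 1 = loop_concat (loop_concat q' (loop_concat q g)) r' 0"
      using pf cl_path_concat[OF cl_path_concat[OF q' qg] r'] by (simp add: cl_path_def)
  qed
  also have "path_homotopic X \<dots> (loop_concat (loop_concat (loop_concat p f) g) r')"
    by (rule path_homotopic_sym[OF path_homotopic_assoc[OF pf g r']])
  also have "path_homotopic X \<dots> (loop_concat (loop_concat p h) r')"
  proof (rule path_homotopic_concat[OF path_homotopic_trans[OF path_homotopic_assoc[OF p f g]
            path_homotopic_concat[OF refl[OF p] h]] refl[OF r']])
    show "p 1 = loop_concat f g 0"
      using p fg by (simp add: cl_path_def)
    show "loop_concat (loop_concat p f) g 1 = r' 0"
      using cl_path_concat[OF pf g] r' by (simp add: cl_path_def)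
  qed
  finally show ?thesis
    by (simp add: based_loop_def ends hends p_q_q'_r'_def)
qed

lemma based_loop_homologous:
  assumes f: "cl_path X x y f"
  shows "path_chain (based_loop f) - (path_chain (\<gamma> x) + path_chain f - path_chain (\<gamma> y))
    \<in> cl_boundaries 1 X"
proof -
  have pts: "x \<in> points X" "y \<in> points X"
    using cl_path_in_points[OF f] by blast+
  have ends: "f 0 = x" "f 1 = y"
    using f by (auto simp: cl_path_def)
  let ?p = "\<gamma> x" and ?r = "path_reverse (\<gamma> y)"
  note p = base_path[OF pts(1)] and r = base_path_reverse[OF pts(2)]
  have "(path_chain ?r + path_chain (\<gamma> y))
      - (path_chain (loop_concat ?p f) + path_chain ?r - path_chain (loop_concat (loop_concat ?p f) ?r))
      - (path_chain ?p + path_chain f - path_chain (loop_concat ?p f)) \<in> cl_boundaries 1 X"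
    by (intro diff_in_boundaries reverse_homologous[OF base_path[OF pts(2)]]
        concat_homologous[OF p f] concat_homologous[OF cl_path_concat[OF p f] r])
  then show ?thesis
    by (simp add: based_loop_def ends algebra_simps)
qed

text \<open>Closing up an arbitrary chain \<open>c\<close> changes it by the base paths to the endpoints, that is by
  a linear function of \<open>\<partial>c\<close>; for a cycle this change is zero.\<close>

lemma cycle_homologous_to_loop:
  assumes c: "c \<in> carrier (cl_cycle_group 1 X)"
  obtains f where "f \<in> cl_loops X x0" "path_chain f - c \<in> cl_boundaries 1 X"
proof -
  \<comment> \<open>the linear extension of \<open>x \<mapsto> \<gamma> x\<close> to 0-chains; the only point of the 0-simplex is \<open>e\<^sub>0\<close>\<close>
  define \<Gamma> :: "'a chain \<Rightarrow> 'a chain"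
    where "\<Gamma> = frag_extend (\<lambda>\<sigma>. path_chain (\<gamma> (\<sigma> (\<lambda>j. if j = 0 then 1 else 0))))"
  have \<Gamma>_point: "\<Gamma> (point_chain x) = path_chain (\<gamma> x)" for x
    by (simp add: \<Gamma>_def point_chain_def)
  have \<Gamma>_diff: "\<Gamma> (a - b) = \<Gamma> a - \<Gamma> b" for a b
    by (simp add: \<Gamma>_def frag_extend_diff)
  have \<Gamma>_0: "\<Gamma> 0 = 0"
    by (simp add: \<Gamma>_def)
  have "\<exists>f \<in> cl_loops X x0. path_chain f - (c - \<Gamma> (chain_boundary 1 c)) \<in> cl_boundaries 1 X"
    if "Poly_Mapping.keys c \<subseteq> cl_singular_simplices 1 X" for c
    using that
  proof (induction c rule: frag_induction)
    case zero
    have e: "restrict (\<lambda>_. x0) {0..1} \<in> cl_loops X x0"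
      by (intro restrict_in_cl_loops cl_path_const base_point)
    have "path_chain (restrict (\<lambda>_. x0) {0..1}) = path_chain (\<lambda>_. x0)"
      by (rule path_chain_cong) simp
    then have "path_chain (restrict (\<lambda>_. x0) {0..1}) - (0 - \<Gamma> (chain_boundary 1 0)) \<in> cl_boundaries 1 X"
      unfolding chain_boundary_0 \<Gamma>_0 diff_zero using const_homologous[OF base_point] by metis
    then show ?case
      using e by blast
  next
    case (one \<sigma>)
    then obtain f where "cl_map {0..1} X f" and \<sigma>: "frag_of \<sigma> = path_chain f"
      unfolding singular_1_simplices path_chain_def by blast
    then have f: "cl_path X (f 0) (f 1) f"
      by (simp add: cl_path_def)
    show ?case
      unfolding \<sigma> boundary_path_chain \<Gamma>_diff \<Gamma>_point
      using based_loop_homologous[OF f] by (intro bexI[OF _ based_loop_in_loops[OF f]]) (simp add: algebra_simps)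
  next
    case (diff a b)
    then obtain f g where f: "f \<in> cl_loops X x0" and g: "g \<in> cl_loops X x0"
      and fa: "path_chain f - (a - \<Gamma> (chain_boundary 1 a)) \<in> cl_boundaries 1 X"
      and gb: "path_chain g - (b - \<Gamma> (chain_boundary 1 b)) \<in> cl_boundaries 1 X"
      by blast
    have pf: "cl_path X x0 x0 f" and pg: "cl_path X x0 x0 g"
      using f g by (simp_all add: cl_loops_iff)
    let ?r = "path_reverse g"
    have loop: "loop_concat f ?r \<in> cl_loops X x0"
      by (rule loop_concat_in_cl_loops[OF pf cl_path_reverse[OF pg]])
    \<comment> \<open>\<open>f\<close> followed by the reverse of \<open>g\<close> is homologous to \<open>f - g\<close>\<close>
    have "(path_chain f - (a - \<Gamma> (chain_boundary 1 a))) - (path_chain g - (b - \<Gamma> (chain_boundary 1 b)))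
      - (path_chain f + path_chain ?r - path_chain (loop_concat f ?r))
      + (path_chain ?r + path_chain g) \<in> cl_boundaries 1 X"
      by (intro add_in_boundaries diff_in_boundaries fa gb reverse_homologous[OF pg]
          concat_homologous[OF pf cl_path_reverse[OF pg]])
    then have "path_chain (loop_concat f ?r) - (a - b - \<Gamma> (chain_boundary 1 (a - b)))
      \<in> cl_boundaries 1 X"
      unfolding chain_boundary_diff \<Gamma>_diff by (simp add: algebra_simps)
    with loop show ?case by blast
  qed
  from this[of c] show ?thesis
    using c that \<Gamma>_0 unfolding cl_cycles_1 by auto
qed

lemma hurewicz_surjective:
  "hurewicz X ` carrier (fundamental_group X x0) = carrier (cl_homology_group 1 X)"
proof
  show "hurewicz X ` carrier (fundamental_group X x0) \<subseteq> carrier (cl_homology_group 1 X)"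
    using hurewicz_hom by (auto simp: hom_def)
  show "carrier (cl_homology_group 1 X) \<subseteq> hurewicz X ` carrier (fundamental_group X x0)"
  proof
    fix z assume "z \<in> carrier (cl_homology_group 1 X)"
    then obtain c where "c \<in> carrier (cl_cycle_group 1 X)" and z: "z = cl_homology_class 1 X c"
      unfolding carrier_homology by blast
    then obtain f where f: "f \<in> cl_loops X x0" and "path_chain f - c \<in> cl_boundaries 1 X"
      using cycle_homologous_to_loop by blast
    then have "z = hurewicz X (loop_class X x0 f)"
      unfolding z hurewicz_loop_class[OF f] by (intro sym[OF homology_class_eq_iff[THEN iffD2]])
    then show "z \<in> hurewicz X ` carrier (fundamental_group X x0)"
      using f unfolding carrier_fundamental_group by blast
  qed
qed

end

section \<open>The kernel\<close>

lemma hom_free_Abelian_group_diff: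
  assumes "group H" and h: "h \<in> hom (free_Abelian_group S) H"
    and ab: "Poly_Mapping.keys a \<subseteq> S" "Poly_Mapping.keys b \<subseteq> S"
  shows "h (a - b) = h a \<otimes>\<^bsub>H\<^esub> inv\<^bsub>H\<^esub> h b"
proof -
  interpret h: group_hom "free_Abelian_group S" H h
    using assms by (simp add: group_hom_def group_hom_axioms_def)
  have "h (- b) = inv\<^bsub>H\<^esub> h b"
    using h.hom_inv[of b] ab by simp
  moreover have "h (a + - b) = h a \<otimes>\<^bsub>H\<^esub> h (- b)"
    using h.hom_mult[of a "- b"] ab by simp
  ultimately show ?thesis by simp
qed

context closure_space_with_base_paths
begin

text \<open>The left inverse of the Hurewicz map on the abelianization: sending a path to the class of the loop closing it up
  extends linearly to 1-chains, with values in the abelianization. On the boundary of a triangle it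
  is trivial because two sides of a triangle concatenate, up to homotopy, to the third.\<close>

lemma kernel_in_commutators:
  "kernel (fundamental_group X x0) (cl_homology_group 1 X) (hurewicz X)
     \<subseteq> derived (fundamental_group X x0) (carrier (fundamental_group X x0))"
proof
  let ?G = "fundamental_group X x0" and ?S = "cl_singular_simplices 1 X"
  define D where "D = derived ?G (carrier ?G)"
  interpret Q: comm_group "?G Mod D"
    unfolding D_def by (rule group.derived_quot_is_comm_group[OF group_fundamental_group])
  have D: "D \<lhd> ?G"
    unfolding D_def by (rule group.derived_self_is_normal[OF group_fundamental_group])
  define q where "q f = D #>\<^bsub>?G\<^esub> loop_class X x0 (based_loop f)" for f
  have class_in: "loop_class X x0 (based_loop f) \<in> carrier ?G" if "cl_map {0..1} X f" for f
    unfolding carrier_fundamental_group using that based_loop_in_loops[of "f 0" "f 1" f]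
    by (simp add: cl_path_def)
  then have q_in: "q f \<in> carrier (?G Mod D)" if "cl_map {0..1} X f" for f
    unfolding q_def carrier_FactGroup using that by blast
  have q_concat: "q f \<otimes>\<^bsub>?G Mod D\<^esub> q g = q h"
    if f: "cl_path X x y f" and g: "cl_path X y z g" and h: "cl_path X x z h"
      and hom: "path_homotopic X (loop_concat f g) h" for x y z f g h
  proof -
    note loops = based_loop_in_loops[OF f] based_loop_in_loops[OF g] based_loop_in_loops[OF h]
    have "loop_class X x0 (based_loop f) \<otimes>\<^bsub>?G\<^esub> loop_class X x0 (based_loop g)
        = loop_class X x0 (based_loop h)"
      unfolding mult_fundamental_group[OF loops(1,2)]
      using loops based_loop_concat[OF f g hom] loop_concat_in_cl_loops
      by (subst loop_class_eq_iff) (auto simp: cl_loops_iff)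
    moreover have "q f \<otimes>\<^bsub>?G Mod D\<^esub> q g
        = D #>\<^bsub>?G\<^esub> (loop_class X x0 (based_loop f) \<otimes>\<^bsub>?G\<^esub> loop_class X x0 (based_loop g))"
      unfolding q_def mult_FactGroup
      using f g by (intro normal.rcos_sum[OF D] class_in) (simp_all add: cl_path_def)
    ultimately show ?thesis
      by (simp add: q_def)
  qed
  have "(\<lambda>\<sigma>. q (simplex_path \<sigma>)) ` ?S \<subseteq> carrier (?G Mod D)"
  proof clarify
    fix \<sigma> assume "\<sigma> \<in> ?S"
    then obtain f where f: "cl_map {0..1} X f" "\<sigma> = loop_simplex f"
      unfolding singular_1_simplices by blast
    then have "cl_map {0..1} X (simplex_path \<sigma>)"
      using cl_map_cong[of "{0..1}" "simplex_path \<sigma>" f X] by (simp add: simplex_path_loop_simplex)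
    then show "q (simplex_path \<sigma>) \<in> carrier (?G Mod D)" by (rule q_in)
  qed
  then obtain \<psi> where \<psi>: "\<psi> \<in> hom (free_Abelian_group ?S) (?G Mod D)"
    and \<psi>_simplex: "\<And>\<sigma>. \<sigma> \<in> ?S \<Longrightarrow> \<psi> (frag_of \<sigma>) = q (simplex_path \<sigma>)"
    by (rule Q.free_Abelian_group_universal) blast
  have \<psi>_path: "\<psi> (path_chain f) = q f" if f: "cl_map {0..1} X f" for f
  proof -
    have "based_loop (simplex_path (loop_simplex f)) = based_loop f"
      by (intro based_loop_cong simplex_path_loop_simplex)
    moreover have "loop_simplex f \<in> ?S"
      unfolding singular_1_simplices using f by blast
    ultimately show ?thesis
      by (simp add: path_chain_def \<psi>_simplex[unfolded One_nat_def] q_def)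
  qed
  have \<psi>_diff: "\<psi> (a - b) = \<psi> a \<otimes>\<^bsub>?G Mod D\<^esub> inv\<^bsub>?G Mod D\<^esub> \<psi> b"
    if "Poly_Mapping.keys a \<subseteq> ?S" "Poly_Mapping.keys b \<subseteq> ?S" for a b
    by (rule hom_free_Abelian_group_diff[OF Q.is_group \<psi> that])
  have \<psi>_0: "\<psi> 0 = \<one>\<^bsub>?G Mod D\<^esub>"
    using hom_one[OF \<psi> group_free_Abelian_group Q.is_group] by simp
  have \<psi>_boundary: "\<psi> d = \<one>\<^bsub>?G Mod D\<^esub>" if "d \<in> cl_boundaries 1 X" for d
    using that
  proof (induction rule: boundaries_induct)
    case zero
    show ?case by (rule \<psi>_0)
  next
    case (diff a b)
    then have "Poly_Mapping.keys a \<subseteq> ?S" "Poly_Mapping.keys b \<subseteq> ?S"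
      using boundaries_subset_cycles cl_cycles_1 by blast+
    then show ?case
      using diff by (simp add: \<psi>_diff del: one_FactGroup mult_FactGroup)
  next
    case (triangle F)
    define ab bc ac where "ab = (\<lambda>t. F (linepath (0, 0) (1, 0) t))"
      "bc = (\<lambda>t. F (linepath (1, 0) (0, 1) t))" "ac = (\<lambda>t. F (linepath (0, 0) (0, 1) t))"
    note lp = cl_map_linepath[OF triangle convex_plane_triangle]
    have paths: "cl_path X (F (0, 0)) (F (1, 0)) ab" "cl_path X (F (1, 0)) (F (0, 1)) bc"
      "cl_path X (F (0, 0)) (F (0, 1)) ac"
      unfolding ab_bc_ac_def by (intro lp mem_plane_triangle)+
    then have maps: "cl_map {0..1} X ab" "cl_map {0..1} X bc" "cl_map {0..1} X ac"
      by (simp_all add: cl_path_def)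
    have in_tri: "linepath u v t \<in> plane_triangle"
      if "u \<in> plane_triangle" "v \<in> plane_triangle" "0 \<le> t" "t \<le> 1" for u v t
      using that convex_plane_triangle by (auto simp: linepath_def intro: convexD_alt)
    have "path_homotopic X (loop_concat ab bc) ac"
    proof (rule path_homotopic_through_convex[OF triangle convex_plane_triangle])
      let ?u = "linepath (0, 0) (1, 0 :: real) :: real \<Rightarrow> real \<times> real"
      let ?v = "linepath (1, 0) (0, 1 :: real) :: real \<Rightarrow> real \<times> real"
      show "continuous_on {0..1} (?u +++ ?v)"
        by (metis path_def path_join_imp path_linepath pathfinish_linepath pathstart_linepath)
      show "(?u +++ ?v) t \<in> plane_triangle" if "0 \<le> t" "t \<le> 1" for t
        using that by (auto simp: joinpaths_def intro!: in_tri mem_plane_triangle)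
      show "loop_concat ab bc t = F ((?u +++ ?v) t)" if "0 \<le> t" "t \<le> 1" for t
        using that by (simp add: loop_concat_def joinpaths_def ab_bc_ac_def)
      show "continuous_on {0..1} (linepath (0, 0) (0, 1 :: real) :: real \<Rightarrow> real \<times> real)"
        by (rule continuous_on_linepath)
      show "linepath (0, 0) (0, 1) t \<in> plane_triangle" if "0 \<le> t" "t \<le> 1" for t
        using that by (intro in_tri mem_plane_triangle)
    qed (simp_all add: joinpaths_def linepath_def ab_bc_ac_def)
    then have "q ab \<otimes>\<^bsub>?G Mod D\<^esub> q bc = q ac"
      by (rule q_concat[OF paths])
    moreover have "\<psi> (path_chain bc - path_chain ac + path_chain ab)
        = q bc \<otimes>\<^bsub>?G Mod D\<^esub> inv\<^bsub>?G Mod D\<^esub> q ac \<otimes>\<^bsub>?G Mod D\<^esub> q ab"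
    proof -
      have keys: "Poly_Mapping.keys (path_chain bc - path_chain ac) \<subseteq> ?S"
        using keys_diff[of "path_chain bc" "path_chain ac"] maps[THEN path_chain_in_chains] by blast
      have "\<psi> (path_chain bc - path_chain ac + path_chain ab)
          = \<psi> (path_chain bc - path_chain ac) \<otimes>\<^bsub>?G Mod D\<^esub> \<psi> (path_chain ab)"
        using hom_mult[OF \<psi>] keys maps(1)[THEN path_chain_in_chains]
        by (metis carrier_free_Abelian_group_iff mult_free_Abelian_group)
      then show ?thesis
        using \<psi>_diff maps \<psi>_path path_chain_in_chains by metis
    qed
    moreover note maps[THEN q_in]
    \<comment> \<open>by commutativity the value on the boundary is \<open>q ab * q bc * inverse (q ac)\<close>\<close>
    ultimately have "\<psi> (path_chain bc - path_chain ac + path_chain ab) = \<one>\<^bsub>?G Mod D\<^esub>"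
      by (metis Q.inv_closed Q.m_assoc Q.m_closed Q.m_comm Q.r_inv)
    then show ?case
      by (simp add: ab_bc_ac_def)
  qed
  fix a assume "a \<in> kernel ?G (cl_homology_group 1 X) (hurewicz X)"
  then have "a \<in> carrier ?G" and one: "hurewicz X a = \<one>\<^bsub>cl_homology_group 1 X\<^esub>"
    by (auto simp: kernel_def)
  then obtain f where f: "f \<in> cl_loops X x0" and a: "a = loop_class X x0 f"
    by (auto simp: carrier_fundamental_group)
  have map_f: "cl_map {0..1} X f" and path_f: "cl_path X x0 x0 f"
    using f by (simp_all add: cl_loops_iff cl_path_def)
  have "path_chain f - 0 \<in> cl_boundaries 1 X"
    using one unfolding a hurewicz_loop_class[OF f] one_homology homology_class_eq_iff .
  then have "q f = D"
    using \<psi>_boundary[of "path_chain f"] \<psi>_path[OF map_f] by simp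
  moreover have "loop_class X x0 (based_loop f) = a"
    using loop_class_eq_iff[OF based_loop_in_loops[OF path_f] f] based_loop_of_loop[OF f] a by simp
  ultimately have "D #>\<^bsub>?G\<^esub> a = D"
    by (simp add: q_def)
  then show "a \<in> derived ?G (carrier ?G)"
    using group.coset_join1[OF group_fundamental_group _ \<open>a \<in> carrier ?G\<close> normal_imp_subgroup[OF D]]
    unfolding D_def by blast
qed

end

section \<open>The Hurewicz theorem\<close>

theorem theorem3p1:
  fixes X :: "'a cl_space" and x0 :: 'a
  assumes "closure_space X" and "cl_path_connected X" and "x0 \<in> points X"
  defines "\<pi>\<^sub>1 \<equiv> fundamental_group X x0" and "H\<^sub>1 \<equiv> cl_homology_group 1 X"
  shows "group_hom \<pi>\<^sub>1 H\<^sub>1 (hurewicz X) \<and>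
    (\<forall>f \<in> cl_loops X x0.
       hurewicz X (loop_class X x0 f) = cl_homology_class 1 X (frag_of (loop_simplex f))) \<and>
    hurewicz X ` carrier \<pi>\<^sub>1 = carrier H\<^sub>1 \<and>
    kernel \<pi>\<^sub>1 H\<^sub>1 (hurewicz X) = commutator_subgroup \<pi>\<^sub>1 \<and>
    (\<lambda>C. the_elem (hurewicz X ` C)) \<in> iso (abelianization \<pi>\<^sub>1) H\<^sub>1"
proof -
  interpret pointed_closure_space X x0
    using assms(1,3) by (simp add: pointed_closure_space_def pointed_closure_space_axioms_def)
  have "\<exists>\<alpha>. cl_path X x0 x \<alpha>" if "x \<in> points X" for x
    using assms(2,3) that unfolding cl_path_connected_def cl_path_def cl_map_def cl_I_def by blast
  then obtain \<beta> where \<beta>: "\<And>x. x \<in> points X \<Longrightarrow> cl_path X x0 x (\<beta> x)"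
    by metis
  \<comment> \<open>the path chosen for \<open>x0\<close> need not be constant, so it is replaced\<close>
  interpret closure_space_with_base_paths X x0 "\<beta>(x0 := (\<lambda>_. x0))"
    by unfold_locales (auto simp: \<beta> cl_path_const base_point)
  have hom: "group_hom \<pi>\<^sub>1 H\<^sub>1 (hurewicz X)"
    unfolding \<pi>\<^sub>1_def H\<^sub>1_def by (rule group_hom_hurewicz)
  moreover have surj: "hurewicz X ` carrier \<pi>\<^sub>1 = carrier H\<^sub>1"
    unfolding \<pi>\<^sub>1_def H\<^sub>1_def by (rule hurewicz_surjective)
  moreover have ker: "kernel \<pi>\<^sub>1 H\<^sub>1 (hurewicz X) = commutator_subgroup \<pi>\<^sub>1"
    unfolding \<pi>\<^sub>1_def H\<^sub>1_def
    using kernel_in_commutators group_hom.derived_in_kernel[OF group_hom_hurewicz comm_group_homology]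
    by (rule equalityI)
  moreover have "(\<lambda>C. the_elem (hurewicz X ` C)) \<in> iso (abelianization \<pi>\<^sub>1) H\<^sub>1"
    using group_hom.FactGroup_iso_set[OF hom surj] unfolding abelianization_def ker .
  ultimately show ?thesis
    using hurewicz_loop_class unfolding path_chain_def by blast
qed

end
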